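(* Let $L,g,\mu,m,H_{\max}>0$ be constants with $h^*:=m/L<H_{\max}$, and let $c$, $R$, $G$, $S$, $V$, $X$, $\|\cdot\|_X$ be as defined in the context ($V$ and $X$ depend on the parameters $q,k$). For every $r\in[0,R)$ and for every $\sigma,q,k>0$ with $$k<q\theta\,\frac{G^{-1}(-cr)}{b+G^{-1}(-cr)},\qquad\text{where } \theta:=\frac{\sigma g}{g+\mu\sigma L},\quad b:=\frac{4mL^2H_{\max}}{\mu\pi^2}\,\theta,$$ there exist constants $M,\lambda>0$ with the following property: every classical solution (in the sense of the context) of the PDE-ODE system $$\dot\xi=w,\quad \dot w=-f,\quad t\ge 0,$$ $$h_t+(hv)_x=0,\quad t>0,\ x\in[0,L],$$ $$(hv)_t+\left(hv^2+\tfrac12 g h^2\right)_x=\mu(hv_x)_x+hf,\quad t>0,\ x\in(0,L),$$ $$v(t,0)=v(t,L)=0,\quad t\ge0,$$ $$\int_0^L h(t,x)\,dx\equiv m,$$ in closed loop with $$f(t)=-\sigma\left(2\int_0^L h(t,x)v(t,x)\,dx+\mu\big(h(t,L)-h(t,0)\big)-q\big(w(t)+k\xi(t)\big)\right),\quad t>0,$$ that satisfies $V(\xi(0),w(0),h[0],v[0])\le r$, also satisfies, for all $t\ge0$, $(\xi(t),w(t),h[t],v[t])\in X$ and $$\left\|(\xi(t),w(t),h[t]-h^*\chi_{[0,L]},v[t])\right\|_X\le M\exp(-\lambda t)\left\|(\xi(0),w(0),h[0]-h^*\chi_{[0,L]},v[0])\right\|_X .$$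
   Context: Notation: $\mathbb{R}_+=[0,+\infty)$. For a function $u(t,x)$, $u[t]$ denotes the profile $x\mapsto u(t,x)$; subscripts $t,x$ denote partial derivatives. $\chi_{[0,L]}$ is the characteristic function of $[0,L]$ (so $h^*\chi_{[0,L]}$ is the constant function $h^*$). $\|u\|_2=\left(\int_0^L|u(x)|^2dx\right)^{1/2}$. $H^1(0,L)$ is the usual Sobolev space. $\operatorname{sgn}(x)=1$ for $x>0$, $\operatorname{sgn}(0)=0$, $\operatorname{sgn}(x)=-1$ for $x<0$. For $A$ between an open set and its closure, $C^k(A)$ means that the derivatives up to order $k$ in the interior exist and extend continuously to $A$; $C^k(A;\Omega)$ denotes such functions with values in $\Omega$. Classical solution: functions $\xi\in C^1(\mathbb{R}_+)\cap C^2((0,+\infty))$, $w\in C^0(\mathbb{R}_+)\cap C^1((0,+\infty))$, $v\in C^0([0,+\infty)\times[0,L])\cap C^1((0,+\infty)\times[0,L])$, $h\in C^1([0,+\infty)\times[0,L];(0,+\infty))\cap C^2((0,+\infty)\times(0,L))$, with $v[t]\in C^2((0,L))$ for each $t>0$, that satisfy the equations of the system with an input $f\in C^0(\mathbb{R}_+)$ (in the closed-loop case $f$ is given by the feedback law for $t>0$). Definitions. $c:=\dfrac{1}{\mu\sqrt g}$ and $$R:=\frac{2\mu\sqrt g}{3}\left(2h^*\sqrt{h^*}+\sqrt{H_{\max}}\,\min\left(H_{\max}-3h^*,0\right)\right).$$ $G:(0,+\infty)\to\left(-\tfrac43h^*\sqrt{h^*},+\infty\right)$ is the increasing $C^1$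 function $$G(h):=\operatorname{sgn}(h-h^* )\left(\tfrac23h\sqrt h-2h^*\sqrt h+\tfrac43h^*\sqrt{h^*}\right),$$ and $G^{-1}$ is its inverse function. $S\subset\mathbb{R}^2\times(C^0([0,L]))^2$ is the set of $(\xi,w,h,v)$ with $(\xi,w)\in\mathbb{R}^2$, $h\in C^0([0,L];(0,+\infty))\cap H^1(0,L)$, $v\in C^0([0,L])$, $\int_0^Lh(x)\,dx=m$, $v(0)=v(L)=0$. For $(\xi,w,h,v)\in S$ (with parameters $k,q>0$): $$V(\xi,w,h,v):=W(h,v)+E(h,v)+\frac{qk^2}{2}\xi^2+\frac q2(w+k\xi)^2,$$ $$E(h,v):=\frac12\int_0^Lh(x)v^2(x)\,dx+\frac12g\int_0^L(h(x)-h^* )^2dx,$$ $$W(h,v):=\frac12\int_0^Lh^{-1}(x)\big(h(x)v(x)+\mu h_x(x)\big)^2dx+\frac12g\int_0^L(h(x)-h^* )^2dx.$$ State space: $X:=\{(\xi,w,h,v)\in S:\ V(\xi,w,h,v)<R\}$. Norm (that of $\mathbb{R}^2\times H^1(0,L)\times L^2(0,L)$): $$\|(\xi,w,h,v)\|_X=\left(\xi^2+w^2+\|h\|_2^2+\|h'\|_2^2+\|v\|_2^2\right)^{1/2}.$$ *)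

theory Defs
  imports "HOL-Analysis.Analysis"
begin

(* C_k k A f: the partial derivatives of f up to order k exist in the interior of A and
   extend continuously to A.  Here f itself is required to be continuous on A, and the
   values of f outside A are irrelevant. *)
primrec C_k :: "nat \<Rightarrow> 'a::euclidean_space set \<Rightarrow> ('a \<Rightarrow> real) \<Rightarrow> bool" where
  "C_k 0 A f \<longleftrightarrow> continuous_on A f"
| "C_k (Suc k) A f \<longleftrightarrow> continuous_on A f \<and>
     (\<forall>b\<in>Basis. \<exists>f'. C_k k A f' \<and>
        (\<forall>z\<in>interior A. ((\<lambda>s. f (z + s *\<^sub>R b)) has_real_derivative f' z) (at 0)))"

definition in_L2 :: "real \<Rightarrow> (real \<Rightarrow> real) \<Rightarrow> bool" where
  "in_L2 L u \<longleftrightarrow> set_borel_measurable lebesgue {0..L} u \<and>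
     set_integrable lebesgue {0..L} (\<lambda>x. (u x)\<^sup>2)"

definition L2_norm :: "real \<Rightarrow> (real \<Rightarrow> real) \<Rightarrow> real" where
  "L2_norm L u = sqrt (LINT x:{0..L}|lebesgue. \<bar>u x\<bar>\<^sup>2)"

definition test_function :: "real \<Rightarrow> (real \<Rightarrow> real) \<Rightarrow> bool" where
  "test_function L \<phi> \<longleftrightarrow> C_k 1 UNIV \<phi> \<and> closure {x. \<phi> x \<noteq> 0} \<subseteq> {0<..<L}"

definition has_weak_deriv :: "real \<Rightarrow> (real \<Rightarrow> real) \<Rightarrow> (real \<Rightarrow> real) \<Rightarrow> bool" where
  "has_weak_deriv L u u' \<longleftrightarrow> (\<forall>\<phi>. test_function L \<phi> \<longrightarrow>
     (LINT x:{0..L}|lebesgue. u x * deriv \<phi> x) = - (LINT x:{0..L}|lebesgue. u' x * \<phi> x))"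

definition in_H1 :: "real \<Rightarrow> (real \<Rightarrow> real) \<Rightarrow> bool" where
  "in_H1 L u \<longleftrightarrow> in_L2 L u \<and> (\<exists>u'. in_L2 L u' \<and> has_weak_deriv L u u')"

(* A representative of the weak derivative: it is determined up to a null set and is only
   used under integrals. *)
definition weak_deriv :: "real \<Rightarrow> (real \<Rightarrow> real) \<Rightarrow> real \<Rightarrow> real" where
  "weak_deriv L u = (SOME u'. in_L2 L u' \<and> has_weak_deriv L u u')"

(* Throughout, hs stands for the equilibrium height m / L. *)

definition c_const :: "real \<Rightarrow> real \<Rightarrow> real" where
  "c_const g \<mu> = 1 / (\<mu> * sqrt g)"

definition R_const :: "real \<Rightarrow> real \<Rightarrow> real \<Rightarrow> real \<Rightarrow> real" where
  "R_const g \<mu> hs Hmax =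
     2 * \<mu> * sqrt g / 3 * (2 * hs * sqrt hs + sqrt Hmax * min (Hmax - 3 * hs) 0)"

definition G_fun :: "real \<Rightarrow> real \<Rightarrow> real" where
  "G_fun hs y = sgn (y - hs) * (2/3 * y * sqrt y - 2 * hs * sqrt y + 4/3 * hs * sqrt hs)"

definition G_inv :: "real \<Rightarrow> real \<Rightarrow> real" where
  "G_inv hs = the_inv_into {0<..} (G_fun hs)"

definition theta :: "real \<Rightarrow> real \<Rightarrow> real \<Rightarrow> real \<Rightarrow> real" where
  "theta L g \<mu> \<sigma> = \<sigma> * g / (g + \<mu> * \<sigma> * L)"

definition b_const :: "real \<Rightarrow> real \<Rightarrow> real \<Rightarrow> real \<Rightarrow> real \<Rightarrow> real \<Rightarrow> real" where
  "b_const L g \<mu> m Hmax \<sigma> = 4 * m * L\<^sup>2 * Hmax / (\<mu> * pi\<^sup>2) * theta L g \<mu> \<sigma>"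

type_synonym state = "real \<times> real \<times> (real \<Rightarrow> real) \<times> (real \<Rightarrow> real)"

definition S_set :: "real \<Rightarrow> real \<Rightarrow> state set" where
  "S_set L m = {(\<xi>, w, h, v).
     continuous_on {0..L} h \<and> (\<forall>x\<in>{0..L}. h x > 0) \<and> in_H1 L h \<and>
     continuous_on {0..L} v \<and>
     (LINT x:{0..L}|lebesgue. h x) = m \<and> v 0 = 0 \<and> v L = 0}"

definition E_fun :: "real \<Rightarrow> real \<Rightarrow> real \<Rightarrow> (real \<Rightarrow> real) \<Rightarrow> (real \<Rightarrow> real) \<Rightarrow> real" where
  "E_fun L g hs h v =
     1/2 * (LINT x:{0..L}|lebesgue. h x * (v x)\<^sup>2) +
     1/2 * g * (LINT x:{0..L}|lebesgue. (h x - hs)\<^sup>2)"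

definition W_fun ::
    "real \<Rightarrow> real \<Rightarrow> real \<Rightarrow> real \<Rightarrow> (real \<Rightarrow> real) \<Rightarrow> (real \<Rightarrow> real) \<Rightarrow> real" where
  "W_fun L g \<mu> hs h v =
     1/2 * (LINT x:{0..L}|lebesgue. inverse (h x) * (h x * v x + \<mu> * weak_deriv L h x)\<^sup>2) +
     1/2 * g * (LINT x:{0..L}|lebesgue. (h x - hs)\<^sup>2)"

definition V_fun :: "real \<Rightarrow> real \<Rightarrow> real \<Rightarrow> real \<Rightarrow> real \<Rightarrow> real \<Rightarrow> state \<Rightarrow> real" where
  "V_fun L g \<mu> m q k = (\<lambda>(\<xi>, w, h, v).
     W_fun L g \<mu> (m / L) h v + E_fun L g (m / L) h v +
     q * k\<^sup>2 / 2 * \<xi>\<^sup>2 + q / 2 * (w + k * \<xi>)\<^sup>2)"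

definition X_set :: "real \<Rightarrow> real \<Rightarrow> real \<Rightarrow> real \<Rightarrow> real \<Rightarrow> real \<Rightarrow> real \<Rightarrow> state set" where
  "X_set L g \<mu> m Hmax q k =
     {s \<in> S_set L m. V_fun L g \<mu> m q k s < R_const g \<mu> (m / L) Hmax}"

definition X_norm :: "real \<Rightarrow> state \<Rightarrow> real" where
  "X_norm L = (\<lambda>(\<xi>, w, h, v).
     sqrt (\<xi>\<^sup>2 + w\<^sup>2 + (L2_norm L h)\<^sup>2 + (L2_norm L (weak_deriv L h))\<^sup>2 + (L2_norm L v)\<^sup>2))"

definition D_t :: "(real \<Rightarrow> real \<Rightarrow> real) \<Rightarrow> real \<Rightarrow> real \<Rightarrow> real" where
  "D_t u t x = deriv (\<lambda>s. u s x) t"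

(* At x = 0 and x = L this is the one-sided derivative, which for functions that are C^1 up
   to the boundary is the continuous extension of the interior derivative. *)
definition D_x :: "real \<Rightarrow> (real \<Rightarrow> real \<Rightarrow> real) \<Rightarrow> real \<Rightarrow> real \<Rightarrow> real" where
  "D_x L u t x = vector_derivative (u t) (at x within {0..L})"

(* Classical solutions for a given input f; u t is the profile of u at time t. *)
definition classical_solution ::
    "real \<Rightarrow> real \<Rightarrow> real \<Rightarrow> real \<Rightarrow> (real \<Rightarrow> real) \<Rightarrow> (real \<Rightarrow> real) \<Rightarrow> (real \<Rightarrow> real) \<Rightarrow>
     (real \<Rightarrow> real \<Rightarrow> real) \<Rightarrow> (real \<Rightarrow> real \<Rightarrow> real) \<Rightarrow> bool" where
  "classical_solution L g \<mu> m f \<xi> w h v \<longleftrightarrow>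
     C_k 0 {0..} f \<and>
     C_k 1 {0..} \<xi> \<and> C_k 2 {0<..} \<xi> \<and>
     C_k 0 {0..} w \<and> C_k 1 {0<..} w \<and>
     C_k 0 ({0..} \<times> {0..L}) (\<lambda>(t, x). v t x) \<and>
     C_k 1 ({0<..} \<times> {0..L}) (\<lambda>(t, x). v t x) \<and>
     (\<forall>t>0. C_k 2 {0<..<L} (v t)) \<and>
     C_k 1 ({0..} \<times> {0..L}) (\<lambda>(t, x). h t x) \<and>
     C_k 2 ({0<..} \<times> {0<..<L}) (\<lambda>(t, x). h t x) \<and>
     (\<forall>t\<ge>0. \<forall>x\<in>{0..L}. h t x > 0) \<and>
     (\<forall>t\<ge>0. (\<xi> has_real_derivative w t) (at t within {0..})) \<and>
     (\<forall>t\<ge>0. (w has_real_derivative - f t) (at t within {0..})) \<and>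
     (\<forall>t>0. \<forall>x\<in>{0..L}. D_t h t x + D_x L (\<lambda>t x. h t x * v t x) t x = 0) \<and>
     (\<forall>t>0. \<forall>x\<in>{0<..<L}.
        D_t (\<lambda>t x. h t x * v t x) t x +
        D_x L (\<lambda>t x. h t x * (v t x)\<^sup>2 + 1/2 * g * (h t x)\<^sup>2) t x =
        \<mu> * D_x L (\<lambda>t x. h t x * D_x L v t x) t x + h t x * f t) \<and>
     (\<forall>t\<ge>0. v t 0 = 0 \<and> v t L = 0) \<and>
     (\<forall>t\<ge>0. (LINT x:{0..L}|lebesgue. h t x) = m)"

definition feedback_law ::
    "real \<Rightarrow> real \<Rightarrow> real \<Rightarrow> real \<Rightarrow> real \<Rightarrow> state \<Rightarrow> real" where
  "feedback_law L \<mu> \<sigma> q k = (\<lambda>(\<xi>, w, h, v).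
     - \<sigma> * (2 * (LINT x:{0..L}|lebesgue. h x * v x) + \<mu> * (h L - h 0) - q * (w + k * \<xi>)))"

end

theory Submission
  imports Defs
begin

text \<open>
  Both energies satisfy balance laws whose fluxes vanish at the walls:
  \<open>E' = f \<integral> h v - \<mu> \<integral> h v\<^sub>x\<^sup>2\<close> and
  \<open>W' = f (\<integral> h v + \<mu> (h(L) - h(0))) - \<mu> g \<integral> h\<^sub>x\<^sup>2\<close>; the second one comes from the
  transport equation \<open>\<phi>\<^sub>t + v \<phi>\<^sub>x = f - g h\<^sub>x\<close> for \<open>\<phi> = v + \<mu> h\<^sub>x / h\<close>.
  With \<open>y = w + k \<xi>\<close> and \<open>A = 2 \<integral> h v + \<mu> (h(L) - h(0))\<close> the feedback is
  \<open>f = - \<sigma> (A - q y)\<close>, and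
  \<open>V' = - D + q k y\<^sup>2 - q k\<^sup>3 \<xi>\<^sup>2\<close> with dissipation
  \<open>D = \<mu> g \<integral> h\<^sub>x\<^sup>2 + \<mu> \<integral> h v\<^sub>x\<^sup>2 + \<sigma> (A - q y)\<^sup>2\<close>.
  Writing \<open>q y = A - (A - q y)\<close>, the Cauchy-Schwarz and Wirtinger inequalities give
  \<open>(q y)\<^sup>2 \<le> (1 + b / h\<^sub>1) D / \<theta>\<close> as long as \<open>h\<^sub>1 \<le> h \<le> H\<^sub>m\<^sub>a\<^sub>x\<close>, so the gain condition
  makes \<open>V' \<le> - \<lambda> V\<close>. The height bounds follow from \<open>\<bar>G(h)\<bar> \<le> c V\<close>, which is AM-GM applied to
  \<open>G(h)\<^sub>x = \<bar>h - h\<^sup>*\<bar> h\<^sub>x / \<surd>h\<close>. Since \<open>r < R\<close> and the gain condition are strict, they hold on a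
  sublevel set slightly larger than \<open>{V \<le> r}\<close>, which \<open>V\<close> can therefore never leave.
\<close>

subsection \<open>Integral inequalities and a decay criterion\<close>

text \<open>The shape of \<open>theta\<close> and \<open>b_const\<close> comes from one weighted
  Cauchy-Schwarz inequality. The three summands of q y are matched with the three parts of D, and
  the inverses of the weights add up: 1/sigma and mu L / g form 1/theta, the velocity term gives b /
  (theta h1). Since b contains pi, Wirtinger's inequality is needed with its exact constant. The
  obstacle is regularity. Second derivatives of h, and the momentum equation, are available only for
  0 < x < L, and v is merely continuous at t = 0. So W cannot simply be differentiated under the
  integral over [0, L], the dissipation estimate is available only for t > 0, and facts at the walls
  or at t = 0 are recovered through continuity. Moreover \<open>weak_deriv\<close> is an arbitrary
  choice and has to be identified almost everywhere with the classical derivative. M and lambda are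
  quantified before the solution, so all constants live in a locale that mentions no
  solution.\<close>

lemma LINT_continuous_eq_integral:
  fixes f :: "real \<Rightarrow> real"
  assumes "continuous_on {a..b} f"
  shows "(LINT x:{a..b}|lebesgue. f x) = integral {a..b} f"
  by (intro set_lebesgue_integral_eq_integral absolutely_integrable_continuous_real assms)

text \<open>Here \<open>l\<close> is the mean of u with respect to the weight p; the inequality is
  the nonnegativity of the weighted variance, multiplied by the total weight.\<close>

lemma integral_weighted_Cauchy_Schwarz:
  fixes p u :: "real \<Rightarrow> real"
  assumes p: "continuous_on {a..b} p" and u: "continuous_on {a..b} u"
    and p0: "\<And>x. x \<in> {a..b} \<Longrightarrow> 0 \<le> p x" and pos: "0 < integral {a..b} p"
  shows "(integral {a..b} (\<lambda>x. p x * u x))\<^sup>2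
    \<le> integral {a..b} p * integral {a..b} (\<lambda>x. p x * (u x)\<^sup>2)"
proof -
  define P where "P = integral {a..b} p"
  define I where "I = integral {a..b} (\<lambda>x. p x * u x)"
  define J where "J = integral {a..b} (\<lambda>x. p x * (u x)\<^sup>2)"
  define l where "l = I / P"
  have "0 \<le> integral {a..b} (\<lambda>x. p x * (u x - l)\<^sup>2)"
    by (intro integral_nonneg integrable_continuous_real continuous_intros p u) (simp add: p0)
  also have "(\<lambda>x. p x * (u x - l)\<^sup>2) = (\<lambda>x. p x * (u x)\<^sup>2 - 2 * l * (p x * u x) + l\<^sup>2 * p x)"
    by (auto simp: power2_eq_square algebra_simps)
  also have "integral {a..b} \<dots> = J - 2 * l * I + l\<^sup>2 * P"
    unfolding J_def I_def P_def
    by (subst integral_add integral_diff integral_mult_right;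
        (intro integrable_continuous_real continuous_intros p u)?)+ simp
  finally have "0 \<le> J - 2 * l * I + l\<^sup>2 * P" .
  hence "0 \<le> P * (J - 2 * l * I + l\<^sup>2 * P)"
    using pos by (simp add: P_def)
  also have "\<dots> = P * J - I\<^sup>2"
    using pos by (simp add: l_def P_def field_simps power2_eq_square)
  finally show ?thesis by (simp add: P_def I_def J_def)
qed

lemma integral_Cauchy_Schwarz_real:
  fixes u :: "real \<Rightarrow> real"
  assumes "a \<le> b" and u: "continuous_on {a..b} u"
  shows "(integral {a..b} u)\<^sup>2 \<le> (b - a) * integral {a..b} (\<lambda>x. (u x)\<^sup>2)"
proof (cases "a = b")
  case False
  with \<open>a \<le> b\<close> show ?thesis
    using integral_weighted_Cauchy_Schwarz[of a b "\<lambda>x. 1" u] u by simp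
qed simp

text \<open>Fundamental theorem plus Cauchy-Schwarz between the two points. The bound is then
  enlarged to the whole interval so that it no longer depends on them.\<close>

lemma increment_square_le:
  fixes u u' :: "real \<Rightarrow> real"
  assumes u: "\<And>x. x \<in> {a..b} \<Longrightarrow> (u has_real_derivative u' x) (at x within {a..b})"
    and u': "continuous_on {a..b} u'" and x: "x \<in> {a..b}" and y: "y \<in> {a..b}"
  shows "(u x - u y)\<^sup>2 \<le> (b - a) * integral {a..b} (\<lambda>x. (u' x)\<^sup>2)"
proof -
  have *: "(u d - u c)\<^sup>2 \<le> (b - a) * integral {a..b} (\<lambda>x. (u' x)\<^sup>2)"
    if "c \<le> d" "c \<in> {a..b}" "d \<in> {a..b}" for c d
  proof -
    have sub: "{c..d} \<subseteq> {a..b}" using that by auto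
    have "(u' has_integral (u d - u c)) {c..d}"
    proof (rule fundamental_theorem_of_calculus[OF \<open>c \<le> d\<close>])
      fix z assume "z \<in> {c..d}"
      thus "(u has_vector_derivative u' z) (at z within {c..d})"
        using u[of z] sub DERIV_subset has_real_derivative_iff_has_vector_derivative by blast
    qed
    hence "(u d - u c)\<^sup>2 = (integral {c..d} u')\<^sup>2" by (simp add: integral_unique)
    also have "\<dots> \<le> (d - c) * integral {c..d} (\<lambda>x. (u' x)\<^sup>2)"
      using that by (intro integral_Cauchy_Schwarz_real continuous_on_subset[OF u' sub]) auto
    also have "\<dots> \<le> (b - a) * integral {a..b} (\<lambda>x. (u' x)\<^sup>2)"
      using that
      by (intro mult_mono integral_subset_le integral_nonneg sub integrable_continuous_real
          continuous_intros continuous_on_subset[OF u' sub] u') auto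
    finally show ?thesis .
  qed
  show ?thesis
    using *[of x y] *[of y x] x y by (cases "x \<le> y") (auto simp: power2_commute)
qed

text \<open>The completed square is \<open>(u' - u c)\<^sup>2\<close> with \<open>c = \<kappa> cot (\<kappa> x + d)\<close>; for \<open>\<kappa> < \<pi> / L\<close> the
  phase \<open>d > 0\<close> keeps the cotangent regular on all of \<open>[0, L]\<close>.\<close>

lemma Wirtinger_shifted:
  fixes u u' :: "real \<Rightarrow> real"
  assumes L: "L > 0" and \<kappa>: "0 < \<kappa>" "\<kappa> * L < pi"
    and u: "\<And>x. x \<in> {0..L} \<Longrightarrow> (u has_real_derivative u' x) (at x within {0..L})"
    and u': "continuous_on {0..L} u'" and bc: "u 0 = 0" "u L = 0"
  shows "\<kappa>\<^sup>2 * integral {0..L} (\<lambda>x. (u x)\<^sup>2) \<le> integral {0..L} (\<lambda>x. (u' x)\<^sup>2)"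
proof -
  \<comment> \<open>This phase centres the range of the angle in (0, pi), so the sine has no zero on
    the closed interval.\<close>
  define d where "d = (pi - \<kappa> * L) / 2"
  define c where "c = (\<lambda>x. \<kappa> * cot (\<kappa> * x + d))"
  have cu: "continuous_on {0..L} u"
    by (rule DERIV_continuous_on) (rule u)
  have sn: "sin (\<kappa> * x + d) \<noteq> 0" if "x \<in> {0..L}" for x
  proof -
    have "0 < \<kappa> * x + d" using that \<kappa> by (auto simp: d_def intro!: add_nonneg_pos)
    moreover have "\<kappa> * x \<le> \<kappa> * L" using that \<kappa> by (intro mult_left_mono) auto
    hence "\<kappa> * x + d \<le> \<kappa> * L + d" by simp
    moreover have "\<kappa> * L + d < pi" using \<kappa> by (simp add: d_def field_simps)
    ultimately show ?thesis using sin_gt_zero by fastforce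
  qed
  \<comment> \<open>The Riccati equation of the cotangent: it makes the exact derivative of u^2 c
    supply precisely the terms that complete the square.\<close>
  have c: "(c has_real_derivative - \<kappa>\<^sup>2 - (c x)\<^sup>2) (at x within {0..L})" if "x \<in> {0..L}" for x
  proof -
    have s: "sin (\<kappa> * x + d) \<noteq> 0" using sn that by blast
    have "(c has_real_derivative \<kappa> * (- inverse ((sin (\<kappa> * x + d))\<^sup>2) * \<kappa>)) (at x within {0..L})"
      unfolding c_def
      by (intro DERIV_cmult DERIV_chain2[where f = cot and g = "\<lambda>x. \<kappa> * x + d" and x = x, OF DERIV_cot[OF s]])
         (rule derivative_eq_intros refl | simp)+
    also have "inverse ((sin (\<kappa> * x + d))\<^sup>2) = 1 + (cot (\<kappa> * x + d))\<^sup>2"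
    proof -
      have "1 + (cot (\<kappa> * x + d))\<^sup>2 =
          ((sin (\<kappa> * x + d))\<^sup>2 + (cos (\<kappa> * x + d))\<^sup>2) / (sin (\<kappa> * x + d))\<^sup>2"
        using s by (simp only: cot_def power_divide add_divide_distrib) simp
      thus ?thesis by (simp only: sin_cos_squared_add inverse_eq_divide)
    qed
    also have "\<kappa> * (- (1 + (cot (\<kappa> * x + d))\<^sup>2) * \<kappa>) = - \<kappa>\<^sup>2 - (c x)\<^sup>2"
      unfolding c_def power2_eq_square by algebra
    finally show ?thesis .
  qed
  have "((\<lambda>x. 2 * u x * u' x * c x + (u x)\<^sup>2 * (- \<kappa>\<^sup>2 - (c x)\<^sup>2)) has_integral
      (u L)\<^sup>2 * c L - (u 0)\<^sup>2 * c 0) {0..L}"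
  proof (rule fundamental_theorem_of_calculus)
    fix x assume x: "x \<in> {0..L}"
    show "((\<lambda>x. (u x)\<^sup>2 * c x) has_vector_derivative
        2 * u x * u' x * c x + (u x)\<^sup>2 * (- \<kappa>\<^sup>2 - (c x)\<^sup>2)) (at x within {0..L})"
      unfolding has_real_derivative_iff_has_vector_derivative[symmetric]
      by (rule DERIV_cong[OF DERIV_mult[OF DERIV_power[OF u[OF x], of 2] c[OF x]]]) simp
  qed (use L in simp)
  hence Q: "((\<lambda>x. 2 * u x * u' x * c x + (u x)\<^sup>2 * (- \<kappa>\<^sup>2 - (c x)\<^sup>2)) has_integral 0) {0..L}"
    by (simp add: bc)
  have "((\<lambda>x. (u' x)\<^sup>2 - \<kappa>\<^sup>2 * (u x)\<^sup>2 -
      (2 * u x * u' x * c x + (u x)\<^sup>2 * (- \<kappa>\<^sup>2 - (c x)\<^sup>2))) has_integral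
     integral {0..L} (\<lambda>x. (u' x)\<^sup>2) - \<kappa>\<^sup>2 * integral {0..L} (\<lambda>x. (u x)\<^sup>2) - 0) {0..L}"
    by (intro has_integral_diff Q has_integral_mult_right integrable_integral
        integrable_continuous_real continuous_intros u' cu)
  also have "(\<lambda>x. (u' x)\<^sup>2 - \<kappa>\<^sup>2 * (u x)\<^sup>2 -
      (2 * u x * u' x * c x + (u x)\<^sup>2 * (- \<kappa>\<^sup>2 - (c x)\<^sup>2))) = (\<lambda>x. (u' x - u x * c x)\<^sup>2)"
    by (auto simp: power2_eq_square algebra_simps)
  finally have "0 \<le> integral {0..L} (\<lambda>x. (u' x)\<^sup>2) - \<kappa>\<^sup>2 * integral {0..L} (\<lambda>x. (u x)\<^sup>2) - 0"
    by (rule has_integral_nonneg) simp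
  thus ?thesis by simp
qed

text \<open>At the critical frequency pi / L the cotangent is singular at the endpoints, so the
  sharp constant is reached as a limit from below.\<close>

lemma Wirtinger_inequality:
  fixes u u' :: "real \<Rightarrow> real"
  assumes L: "L > 0"
    and u: "\<And>x. x \<in> {0..L} \<Longrightarrow> (u has_real_derivative u' x) (at x within {0..L})"
    and u': "continuous_on {0..L} u'" and bc: "u 0 = 0" "u L = 0"
  shows "(pi / L)\<^sup>2 * integral {0..L} (\<lambda>x. (u x)\<^sup>2) \<le> integral {0..L} (\<lambda>x. (u' x)\<^sup>2)"
proof (rule tendsto_upperbound)
  show "((\<lambda>\<kappa>. \<kappa>\<^sup>2 * integral {0..L} (\<lambda>x. (u x)\<^sup>2)) \<longlongrightarrow>
      (pi / L)\<^sup>2 * integral {0..L} (\<lambda>x. (u x)\<^sup>2)) (at_left (pi / L))"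
    by (intro tendsto_intros)
  have "\<forall>\<^sub>F \<kappa> in at_left (pi / L). 0 < \<kappa> \<and> \<kappa> < pi / L"
    using eventually_at_left_real[of 0 "pi / L"] L by (auto elim: eventually_mono)
  thus "\<forall>\<^sub>F \<kappa> in at_left (pi / L). \<kappa>\<^sup>2 * integral {0..L} (\<lambda>x. (u x)\<^sup>2)
      \<le> integral {0..L} (\<lambda>x. (u' x)\<^sup>2)"
  proof eventually_elim
    case (elim \<kappa>)
    show ?case
      by (rule Wirtinger_shifted[OF L _ _ u u' bc]) (use elim L in \<open>auto simp: field_simps\<close>)
  qed
qed simp

text \<open>The differential inequality is known only below r', so it cannot be integrated at once.
  The gap between r and r' closes the circle: until the first time a level above r is reached, V is
  nonincreasing, so that level is never reached. Then the exponential is an integrating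
  factor.\<close>

lemma decay_from_barrier:
  fixes V V' :: "real \<Rightarrow> real"
  assumes cont: "continuous_on {0..} V"
    and deriv: "\<And>t. t > 0 \<Longrightarrow> (V has_real_derivative V' t) (at t)"
    and dec: "\<And>t. t > 0 \<Longrightarrow> V t \<le> r' \<Longrightarrow> V' t \<le> - l * V t"
    and nn: "\<And>t. t \<ge> 0 \<Longrightarrow> 0 \<le> V t" and l: "l > 0" and init: "V 0 \<le> r" "r < r'" and t: "t \<ge> 0"
  shows "V t \<le> r" "V t \<le> exp (- l * t) * V 0"
proof -
  have below: "V s \<le> r" if s: "s \<ge> 0" for s
  proof (rule ccontr)
    assume "\<not> V s \<le> r"
    \<comment> \<open>Being at most r' makes \<open>dec\<close> applicable wherever V < d; being at
      most V s makes the set of times with V at least d nonempty.\<close>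
    define d where "d = min (V s) r'"
    have d: "r < d" "d \<le> V s" "d \<le> r'" using \<open>\<not> V s \<le> r\<close> init by (auto simp: d_def)
    define T where "T = {t \<in> {0..s}. d \<le> V t}"
    have "T = {0..s} \<inter> V -` {d..}" by (auto simp: T_def)
    hence "closed T"
      by (metis continuous_on_subset[OF cont] continuous_closed_preimage closed_atLeast
          closed_atLeastAtMost atLeastAtMost_iff subsetI atLeast_iff)
    moreover have "bounded T" by (rule bounded_subset[of "{0..s}"]) (auto simp: T_def)
    ultimately have "compact T" by (simp add: compact_eq_bounded_closed)
    moreover have "T \<noteq> {}" using s d by (auto simp: T_def)
    ultimately obtain \<tau> where \<tau>: "\<tau> \<in> T" "\<And>t. t \<in> T \<Longrightarrow> \<tau> \<le> t"
      using compact_attains_inf by metis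
    have "V \<tau> \<le> V 0"
    proof (rule DERIV_nonpos_imp_decreasing_open[where f = V])
      show "0 \<le> \<tau>" using \<tau> by (auto simp: T_def)
      show "continuous_on {0..\<tau>} V" by (rule continuous_on_subset[OF cont]) auto
      fix x assume x: "0 < x" "x < \<tau>"
      have "V x < d"
        using \<tau>(2)[of x] \<tau>(1) x by (auto simp: T_def not_le[symmetric])
      hence "V' x \<le> - l * V x" using dec[of x] x d by simp
      also have "\<dots> \<le> 0" using nn[of x] x l by simp
      finally show "\<exists>y. DERIV V x :> y \<and> y \<le> 0" using deriv x by blast
    qed
    thus False using \<tau> d init by (auto simp: T_def)
  qed
  show "V t \<le> r" using below t .
  have "V t * exp (l * t) \<le> V 0 * exp (l * 0)"
  proof (rule DERIV_nonpos_imp_decreasing_open[where f = "\<lambda>t. V t * exp (l * t)"])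
    show "continuous_on {0..t} (\<lambda>t. V t * exp (l * t))"
      by (intro continuous_intros continuous_on_subset[OF cont]) auto
    fix x assume x: "0 < x" "x < t"
    have "((\<lambda>t. V t * exp (l * t)) has_real_derivative (V' x + l * V x) * exp (l * x)) (at x)"
      by (rule derivative_eq_intros deriv x refl | simp add: algebra_simps)+
    moreover have "(V' x + l * V x) * exp (l * x) \<le> 0"
      using dec[of x] below[of x] x init by (intro mult_nonpos_nonneg) auto
    ultimately show "\<exists>y. DERIV (\<lambda>t. V t * exp (l * t)) x :> y \<and> y \<le> 0" by blast
  qed (use t in simp)
  thus "V t \<le> exp (- l * t) * V 0" by (simp add: exp_minus field_simps)
qed

subsection \<open>Balance laws\<close>

lemma integral_truncation_le:
  fixes u :: "real \<Rightarrow> real"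
  assumes u: "continuous_on {0..L} u" and B: "\<And>x. x \<in> {0..L} \<Longrightarrow> \<bar>u x\<bar> \<le> B"
    and e: "0 \<le> e" "2 * e \<le> L"
  shows "\<bar>integral {0..L} u - integral {e..L - e} u\<bar> \<le> 2 * e * B"
proof -
  have cont: "continuous_on {c..d} u" if "0 \<le> c" "d \<le> L" for c d
    by (rule continuous_on_subset[OF u]) (use that in auto)
  have i: "u integrable_on {0..L}" "u integrable_on {e..L}"
    using e by (auto intro!: integrable_continuous_real cont)
  have "integral {0..e} u + integral {e..L} u = integral {0..L} u"
    by (rule Henstock_Kurzweil_Integration.integral_combine) (use e i in auto)
  moreover have "integral {e..L - e} u + integral {L - e..L} u = integral {e..L} u"
    by (rule Henstock_Kurzweil_Integration.integral_combine) (use e i in auto)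
  moreover have "\<bar>integral {0..e} u\<bar> \<le> B * (e - 0)"
    unfolding real_norm_def[symmetric]
    by (rule integral_bound) (use e in \<open>auto intro!: cont B\<close>)
  moreover have "\<bar>integral {L - e..L} u\<bar> \<le> B * (L - (L - e))"
    unfolding real_norm_def[symmetric]
    by (rule integral_bound) (use e in \<open>auto intro!: cont B\<close>)
  ultimately show ?thesis by (simp add: algebra_simps)
qed

lemma continuous_on_slice:
  assumes "continuous_on (A \<times> B) (\<lambda>(t, x). F t x)" and "t \<in> A"
  shows "continuous_on B (F t)"
proof -
  have "continuous_on B (\<lambda>x. (t, x))" by (intro continuous_intros)
  from continuous_on_compose2[OF assms(1) this] show ?thesis using assms(2) by auto
qed

text \<open>The derivative \<open>Ft\<close> need not extend to the boundary, so the integral is truncated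
  to \<open>[e, L - e]\<close>, where the Leibniz rule applies, and \<open>e\<close> tends to \<open>0\<close>: the fluxes through
  the cuts vanish in the limit, uniformly in time.\<close>

lemma balance_law_has_derivative:
  fixes F P S Ft :: "real \<Rightarrow> real \<Rightarrow> real"
  assumes L: "L > 0"
    and F: "continuous_on ({0<..} \<times> {0..L}) (\<lambda>(t, x). F t x)"
    and P: "continuous_on ({0<..} \<times> {0..L}) (\<lambda>(t, x). P t x)"
    and S: "continuous_on ({0<..} \<times> {0..L}) (\<lambda>(t, x). S t x)"
    and Ft: "continuous_on ({0<..} \<times> {0<..<L}) (\<lambda>(t, x). Ft t x)"
    and dF: "\<And>t x. 0 < t \<Longrightarrow> x \<in> {0<..<L} \<Longrightarrow> ((\<lambda>s. F s x) has_real_derivative Ft t x) (at t)"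
    and dP: "\<And>t x. 0 < t \<Longrightarrow> x \<in> {0<..<L} \<Longrightarrow>
      (P t has_real_derivative S t x - Ft t x) (at x)"
    and bc: "\<And>t. 0 < t \<Longrightarrow> P t 0 = 0" "\<And>t. 0 < t \<Longrightarrow> P t L = 0"
    and t: "0 < t"
  shows "((\<lambda>t. integral {0..L} (F t)) has_real_derivative integral {0..L} (S t)) (at t)"
proof -
  \<comment> \<open>A compact window around t that stays away from time 0; compactness makes the
    bounds and the modulus of continuity uniform in time.\<close>
  define K where "K = {t / 2..2 * t}"
  \<comment> \<open>The shift by 3 keeps 2 e below L already for n = 0.\<close>
  define e where "e = (\<lambda>n. L / real (n + 3))"
  define f where "f = (\<lambda>n s. integral {e n..L - e n} (F s))"
  define D where "D = (\<lambda>n s. integral {e n..L - e n} (S s) - (P s (L - e n) - P s (e n)))"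
  have K: "K \<subseteq> {0<..}" "compact (K \<times> {0..L})" "convex K"
    using t by (auto simp: K_def intro: compact_Times)
  have KL: "K \<times> {0..L} \<subseteq> {0<..} \<times> {0..L}" using K by auto
  have e: "0 < e n" "2 * e n < L" for n using L by (auto simp: e_def field_simps add_pos_nonneg)
  have e0: "e \<longlonglongrightarrow> 0" unfolding e_def
    by (rule LIMSEQ_ignore_initial_segment[OF lim_const_over_n])
  have cont: "continuous_on {c..d} (G s)"
    if "continuous_on ({0<..} \<times> {0..L}) (\<lambda>(t, x). G t x)" "s \<in> K" "0 \<le> c" "d \<le> L"
    for G :: "real \<Rightarrow> real \<Rightarrow> real" and s c d
    by (rule continuous_on_subset[OF continuous_on_slice[OF that(1)]]) (use that K in auto)
  have bdd: "\<exists>B\<ge>0. \<forall>s\<in>K. \<forall>x\<in>{0..L}. \<bar>G s x\<bar> \<le> B"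
    if G: "continuous_on ({0<..} \<times> {0..L}) (\<lambda>(t, x). G t x)" for G :: "real \<Rightarrow> real \<Rightarrow> real"
  proof -
    have "bounded ((\<lambda>(t, x). G t x) ` (K \<times> {0..L}))"
      by (intro compact_imp_bounded compact_continuous_image K continuous_on_subset[OF G KL])
    then obtain B where "\<And>z. z \<in> K \<times> {0..L} \<Longrightarrow> \<bar>(\<lambda>(t, x). G t x) z\<bar> \<le> B"
      unfolding bounded_iff by (auto simp: image_iff)
    thus ?thesis by (intro exI[of _ "\<bar>B\<bar>"]) force
  qed
  have deriv: "(f n has_derivative (\<lambda>h. h * D n s)) (at s within K)" if s: "s \<in> K" for n s
  proof -
    have "((\<lambda>s. integral (cbox (e n) (L - e n)) (F s)) has_field_derivative
        integral (cbox (e n) (L - e n)) (Ft s)) (at s within K)"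
    proof (rule leibniz_rule_field_derivative)
      show "((\<lambda>s. F s x) has_real_derivative Ft r x) (at r within K)"
        if "r \<in> K" "x \<in> cbox (e n) (L - e n)" for r x
        by (rule has_field_derivative_at_within[OF dF]) (use that K e[of n] in auto)
      show "F r integrable_on cbox (e n) (L - e n)" if "r \<in> K" for r
        using cont[OF F that, of "e n" "L - e n"] e[of n]
        by (auto intro!: integrable_continuous_real)
      show "continuous_on (K \<times> cbox (e n) (L - e n)) (\<lambda>(s, x). Ft s x)"
        by (rule continuous_on_subset[OF Ft]) (use e[of n] K in auto)
    qed (use s K in auto)
    moreover have "((\<lambda>x. S s x - Ft s x) has_integral P s (L - e n) - P s (e n)) {e n..L - e n}"
    proof (rule fundamental_theorem_of_calculus)
      fix x assume "x \<in> {e n..L - e n}"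
      thus "(P s has_vector_derivative S s x - Ft s x) (at x within {e n..L - e n})"
        unfolding has_real_derivative_iff_has_vector_derivative[symmetric]
        by (intro has_field_derivative_at_within[OF dP]) (use s K e[of n] in auto)
    qed (use e[of n] in simp)
    moreover have "(S s has_integral integral {e n..L - e n} (S s)) {e n..L - e n}"
      using cont[OF S s, of "e n" "L - e n"] e[of n]
      by (intro integrable_integral integrable_continuous_real) simp
    ultimately have "((\<lambda>x. S s x - (S s x - Ft s x)) has_integral D n s) {e n..L - e n}"
      unfolding D_def using has_integral_diff by blast
    hence "integral {e n..L - e n} (Ft s) = D n s" by (simp add: integral_unique)
    thus ?thesis
      using \<open>((\<lambda>s. integral (cbox (e n) (L - e n)) (F s)) has_field_derivative _) _\<close>
      by (simp add: f_def has_field_derivative_def mult_commute_abs)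
  qed
  \<comment> \<open>Two errors are estimated: the source over the two removed strips, small because
    S is bounded, and the fluxes through the cuts, small because P is uniformly continuous and zero
    at the walls.\<close>
  have unif: "\<forall>\<^sub>F n in sequentially. \<forall>s\<in>K. \<bar>D n s - integral {0..L} (S s)\<bar> \<le> \<epsilon>"
    if \<epsilon>: "\<epsilon> > 0" for \<epsilon>
  proof -
    obtain B where B: "B \<ge> 0" "\<And>s x. s \<in> K \<Longrightarrow> x \<in> {0..L} \<Longrightarrow> \<bar>S s x\<bar> \<le> B"
      using bdd[OF S] by blast
    have "uniformly_continuous_on (K \<times> {0..L}) (\<lambda>(t, x). P t x)"
      by (intro compact_uniformly_continuous K continuous_on_subset[OF P KL])
    then obtain d where d: "d > 0" "\<And>z z'. z \<in> K \<times> {0..L} \<Longrightarrow> z' \<in> K \<times> {0..L} \<Longrightarrow>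
        dist z' z < d \<Longrightarrow> dist ((\<lambda>(t, x). P t x) z') ((\<lambda>(t, x). P t x) z) < \<epsilon> / 3"
      unfolding uniformly_continuous_on_def using \<epsilon> by (metis divide_pos_pos zero_less_numeral)
    have P_small: "\<bar>P s x - P s y\<bar> < \<epsilon> / 3"
      if "s \<in> K" "x \<in> {0..L}" "y \<in> {0..L}" "\<bar>x - y\<bar> < d" for s x y
      using d(2)[of "(s, y)" "(s, x)"] that by (auto simp: dist_Pair_Pair dist_real_def)
    have "(\<lambda>n. 2 * e n * B) \<longlonglongrightarrow> 2 * 0 * B" by (intro tendsto_intros e0)
    hence "\<forall>\<^sub>F n in sequentially. 2 * e n * B < \<epsilon> / 3"
      using \<epsilon> by (intro order_tendstoD(2)) auto
    moreover have "\<forall>\<^sub>F n in sequentially. e n < d" using e0 d by (intro order_tendstoD(2)) auto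
    ultimately show ?thesis
    proof eventually_elim
      case (elim n)
      show ?case
      proof
        fix s assume s: "s \<in> K"
        have "\<bar>integral {0..L} (S s) - integral {e n..L - e n} (S s)\<bar> \<le> 2 * e n * B"
          by (rule integral_truncation_le) (use e[of n] B s in \<open>auto intro!: cont S\<close>)
        moreover have "\<bar>P s (L - e n) - P s L\<bar> < \<epsilon> / 3" "\<bar>P s (e n) - P s 0\<bar> < \<epsilon> / 3"
          by (rule P_small[OF s]; use e[of n] elim L in simp)+
        moreover have "P s 0 = 0" "P s L = 0" using s K bc by auto
        ultimately show "\<bar>D n s - integral {0..L} (S s)\<bar> \<le> \<epsilon>"
          unfolding D_def using elim by linarith
      qed
    qed
  qed
  have lim: "(\<lambda>n. f n s) \<longlonglongrightarrow> integral {0..L} (F s)" if s: "s \<in> K" for s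
  proof -
    obtain B where B: "B \<ge> 0" "\<And>s x. s \<in> K \<Longrightarrow> x \<in> {0..L} \<Longrightarrow> \<bar>F s x\<bar> \<le> B"
      using bdd[OF F] by blast
    have "(\<lambda>n. integral {0..L} (F s) - f n s) \<longlonglongrightarrow> 0"
    proof (rule Lim_null_comparison)
      show "\<forall>\<^sub>F n in sequentially. norm (integral {0..L} (F s) - f n s) \<le> 2 * e n * B"
        unfolding f_def real_norm_def
        by (intro always_eventually allI integral_truncation_le)
           (use e B s in \<open>auto intro!: cont F less_imp_le\<close>)
      show "(\<lambda>n. 2 * e n * B) \<longlonglongrightarrow> 0"
        by (rule tendsto_eq_intros e0 | simp)+
    qed
    from tendsto_diff[OF tendsto_const[of "integral {0..L} (F s)"] this] show ?thesis by simp
  qed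
  have tK: "t \<in> K" "t \<in> interior K" using t by (auto simp: K_def interior_atLeastAtMost_real)
  \<comment> \<open>Uniform convergence of the derivatives permits differentiating the limit;
    \<open>lim\<close> then identifies that limit with the integral over all of [0, L].\<close>
  have "\<exists>g. \<forall>s\<in>K. (\<lambda>n. f n s) \<longlonglongrightarrow> g s \<and>
      (g has_derivative (\<lambda>h. h * integral {0..L} (S s))) (at s within K)"
  proof (rule has_derivative_sequence)
    fix \<epsilon> :: real assume "\<epsilon> > 0"
    from unif[OF this] show "\<forall>\<^sub>F n in sequentially. \<forall>s\<in>K. \<forall>h.
        norm (h * D n s - h * integral {0..L} (S s)) \<le> \<epsilon> * norm h"
    proof eventually_elim
      case (elim n)
      thus ?case
        by (auto simp: right_diff_distrib[symmetric] abs_mult mult.commute[of \<epsilon>]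
            intro!: mult_left_mono)
    qed
  qed (use K deriv tK lim in auto)
  then obtain g where g: "\<And>s. s \<in> K \<Longrightarrow> (\<lambda>n. f n s) \<longlonglongrightarrow> g s"
    "(g has_derivative (\<lambda>h. h * integral {0..L} (S t))) (at t within K)"
    using tK by blast
  have "g s = integral {0..L} (F s)" if "s \<in> K" for s
    using LIMSEQ_unique g(1) lim that by blast
  hence "((\<lambda>t. integral {0..L} (F t)) has_derivative (\<lambda>h. h * integral {0..L} (S t)))
      (at t within K)"
    by (intro has_derivative_transform[OF tK(1) _ g(2)]) auto
  thus ?thesis
    using at_within_interior[OF tK(2)]
    by (simp add: has_field_derivative_def mult_commute_abs)
qed

subsection \<open>Weak derivatives\<close>

text \<open>The positive part has a corner at 0, its square is continuously differentiable; this
  gives \<open>bump\<close> the smoothness required of a test function.\<close>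

lemma DERIV_max_zero_power2:
  "((\<lambda>z::real. (max 0 z)\<^sup>2) has_real_derivative 2 * max 0 z) (at z)"
proof (cases "z = 0")
  case True
  have "((\<lambda>h. (max 0 h)\<^sup>2 / h) \<longlongrightarrow> 0) (at (0::real))"
  proof (rule Lim_null_comparison)
    show "\<forall>\<^sub>F h in at (0::real). norm ((max 0 h)\<^sup>2 / h) \<le> \<bar>h\<bar>"
      by (intro always_eventually allI) (auto simp: max_def power2_eq_square)
    show "((\<lambda>h. \<bar>h\<bar>) \<longlongrightarrow> 0) (at (0::real))" by (rule tendsto_rabs_zero) simp
  qed
  thus ?thesis using True by (simp add: DERIV_def)
next
  case False
  show ?thesis
  proof (cases "z > 0")
    case True
    have "((\<lambda>z::real. z\<^sup>2) has_real_derivative 2 * z) (at z)"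
      by (rule derivative_eq_intros refl | simp)+
    from has_field_derivative_transform_within_open[OF this, of "{0<..}" "\<lambda>z. (max 0 z)\<^sup>2"]
    show ?thesis using True by simp
  next
    case False
    with \<open>z \<noteq> 0\<close> have "z < 0" by simp
    have "((\<lambda>z::real. 0) has_real_derivative 0) (at z)" by simp
    from has_field_derivative_transform_within_open[OF this, of "{..<0}" "\<lambda>z. (max 0 z)\<^sup>2"]
    show ?thesis using \<open>z < 0\<close> by simp
  qed
qed

lemma C_k_1_real_iff:
  fixes f :: "real \<Rightarrow> real"
  shows "C_k 1 A f \<longleftrightarrow> continuous_on A f \<and>
    (\<exists>f'. continuous_on A f' \<and> (\<forall>z\<in>interior A. (f has_real_derivative f' z) (at z)))"
proof -
  have "((\<lambda>s. f (z + s)) has_real_derivative D) (at 0) \<longleftrightarrow> (f has_real_derivative D) (at z)" for z D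
    using DERIV_shift[of f D 0 z] by (simp add: add.commute)
  thus ?thesis by simp
qed

text \<open>The positive and negative parts of u are densities of two finite measures. They agree on
  all half-lines, which determine a finite Borel measure, so the densities agree almost everywhere.
  Passing to a Borel representative \<open>v\<close> lets this be done with
  \<open>lborel\<close>.\<close>

lemma AE_eq_0_if_integral_Ioi_eq_0:
  fixes u :: "real \<Rightarrow> real"
  assumes u: "integrable lebesgue u" and zero: "\<And>a. (LINT x:{a<..}|lebesgue. u x) = 0"
  shows "AE x in lebesgue. u x = 0"
proof -
  obtain v where v[measurable]: "v \<in> borel_measurable borel" and uv: "AE x in lborel. u x = v x"
    using completion_ex_borel_measurable_real[OF borel_measurable_integrable[OF u]]
    by (auto simp: measurable_lborel1)
  have vl: "v \<in> borel_measurable lebesgue" by (simp add: measurable_completion)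
  have uv': "AE x in lebesgue. u x = v x" using uv by (rule AE_completion)
  have "integrable lebesgue v"
    using integrable_cong_AE_imp[OF u vl] uv' by (simp add: eq_commute)
  hence iv: "integrable lborel v" by (subst integrable_completion[symmetric]) auto
  define M where "M = density lborel (\<lambda>x. ennreal (v x))"
  define N where "N = density lborel (\<lambda>x. ennreal (- v x))"
  have fin: "(\<integral>\<^sup>+ x. ennreal (v x) \<partial>lborel) < \<infinity>" "(\<integral>\<^sup>+ x. ennreal (- v x) \<partial>lborel) < \<infinity>"
    using iv by (auto simp: real_integrable_def less_top)
  have MN: "emeasure M A = (\<integral>\<^sup>+ x. ennreal (indicator A x * v x) \<partial>lborel)"
     "emeasure N A = (\<integral>\<^sup>+ x. ennreal (- (indicator A x * v x)) \<partial>lborel)"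
    if "A \<in> sets borel" for A
    using that unfolding M_def N_def
    by (auto simp: emeasure_density intro!: nn_integral_cong split: split_indicator)
  have finA: "emeasure M A < \<infinity>" "emeasure N A < \<infinity>" if "A \<in> sets borel" for A
  proof -
    have "emeasure M A \<le> (\<integral>\<^sup>+ x. ennreal (v x) \<partial>lborel)"
      "emeasure N A \<le> (\<integral>\<^sup>+ x. ennreal (- v x) \<partial>lborel)"
      unfolding MN[OF that] by (auto intro!: nn_integral_mono split: split_indicator)
    thus "emeasure M A < \<infinity>" "emeasure N A < \<infinity>" using fin by auto
  qed
  have "M = N"
  proof (rule measure_eqI_lessThan)
    fix a :: real
    have i: "integrable lborel (\<lambda>x. indicator {a<..} x * v x)"
      using integrable_mult_indicator[OF _ iv, of "{a<..}"] by simp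
    have "0 = (LINT x|lebesgue. indicator {a<..} x * v x)"
      using zero[of a] uv' unfolding set_lebesgue_integral_def
      by (subst integral_cong_AE[of _ _ "\<lambda>x. indicator {a<..} x *\<^sub>R u x"])
         (auto intro!: vl borel_measurable_times borel_measurable_indicator
           borel_measurable_scaleR borel_measurable_integrable[OF u])
    also have "\<dots> = (LINT x|lborel. indicator {a<..} x * v x)"
      by (rule integral_completion) simp
    also have "\<dots> = enn2real (emeasure M {a<..}) - enn2real (emeasure N {a<..})"
      unfolding real_lebesgue_integral_def[OF i] by (simp add: MN)
    finally have "enn2real (emeasure M {a<..}) = enn2real (emeasure N {a<..})" by simp
    thus "emeasure M {a<..} = emeasure N {a<..}"
      using finA[of "{a<..}"] ennreal_enn2real by (metis greaterThan_borel infinity_ennreal_def)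
    show "emeasure M {a<..} < \<infinity>" using finA by simp
  qed (auto simp: M_def N_def)
  \<comment> \<open>Since \<open>ennreal\<close> sends negative numbers to 0, one side is always 0,
    and equality forces v x = 0.\<close>
  hence "AE x in lborel. ennreal (v x) = ennreal (- v x)"
    unfolding M_def N_def
    by (subst (asm) sigma_finite_measure.density_unique_iff[OF sigma_finite_lborel]) auto
  hence "AE x in lborel. v x = 0"
  proof eventually_elim
    case (elim x)
    show ?case
    proof (cases "0 \<le> v x")
      case True
      hence "ennreal (v x) = 0" using elim by (simp add: ennreal_neg)
      thus ?thesis using True by simp
    next
      case False
      hence "ennreal (- v x) = 0" using elim by (simp add: ennreal_neg)
      thus ?thesis using False by simp
    qed
  qed
  hence "AE x in lebesgue. v x = 0" by (rule AE_completion)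
  with uv' show ?thesis by eventually_elim simp
qed

text \<open>With s the positive part of (x - a)(b - x), this is n s^2 / (1 + n s^2): a rational C^1
  cutoff that is supported in [a, b], stays between 0 and 1, and rises to 1 on the open interval as
  n grows.\<close>

definition bump :: "real \<Rightarrow> real \<Rightarrow> real \<Rightarrow> real \<Rightarrow> real" where
  "bump n a b x = n * (max 0 ((x - a) * (b - x)))\<^sup>2 / (1 + n * (max 0 ((x - a) * (b - x)))\<^sup>2)"

lemma bump_bounds:
  assumes "0 \<le> n" shows "0 \<le> bump n a b x" "bump n a b x \<le> 1"
  using assms by (auto simp: bump_def divide_le_eq add_pos_nonneg add_nonneg_nonneg)

lemma bump_eq_0: "a \<le> b \<Longrightarrow> x \<le> a \<or> b \<le> x \<Longrightarrow> bump n a b x = 0"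
  by (auto simp: bump_def max_def mult_nonpos_nonneg mult_nonneg_nonpos dest: antisym)

lemma test_function_bump:
  assumes n: "0 \<le> n" and ab: "0 < a" "a \<le> b" "b < L"
  shows "test_function L (bump n a b)"
proof -
  define s where "s = (\<lambda>x. (max 0 ((x - a) * (b - x)))\<^sup>2)"
  define s' where "s' = (\<lambda>x. 2 * max 0 ((x - a) * (b - x)) * (b + a - 2 * x))"
  have s: "(s has_real_derivative s' x) (at x)" for x
  proof -
    have "((\<lambda>x. (x - a) * (b - x)) has_real_derivative (b + a - 2 * x)) (at x)"
      by (rule derivative_eq_intros refl | simp)+
    from DERIV_chain2[OF DERIV_max_zero_power2 this] show ?thesis by (simp add: s_def s'_def)
  qed
  have pos: "1 + n * s x \<noteq> 0" for x
    using n by (simp add: s_def add_nonneg_eq_0_iff)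
  have bump: "bump n a b = (\<lambda>x. n * s x / (1 + n * s x))" by (auto simp: bump_def s_def)
  have "(bump n a b has_real_derivative n * s' x / (1 + n * s x)\<^sup>2) (at x)" for x
    unfolding bump
    by (rule derivative_eq_intros s refl pos | simp add: pos field_simps power2_eq_square)+
  moreover have "continuous_on UNIV (\<lambda>x. n * s' x / (1 + n * s x)\<^sup>2)"
    using pos unfolding s_def s'_def by (intro continuous_intros) auto
  ultimately have "C_k 1 UNIV (bump n a b)"
    unfolding C_k_1_real_iff
    by (auto intro!: DERIV_continuous_on[of UNIV, simplified])
  moreover have "closure {x. bump n a b x \<noteq> 0} \<subseteq> {a..b}"
  proof (rule closure_minimal)
    show "{x. bump n a b x \<noteq> 0} \<subseteq> {a..b}"
    proof
      fix x assume "x \<in> {x. bump n a b x \<noteq> 0}"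
      thus "x \<in> {a..b}" using bump_eq_0[OF ab(2), of x n] by (cases "x \<le> a \<or> b \<le> x") auto
    qed
  qed simp
  ultimately show ?thesis unfolding test_function_def using ab by force
qed

text \<open>The margins allow each bump to have its support strictly inside (a, b), while the limit
  still fills (a, b). At an interior point s has a positive limit, so n s^2 tends to
  infinity.\<close>

lemma bump_LIMSEQ:
  assumes "a < b" and \<delta>: "\<delta> \<longlonglongrightarrow> 0" "\<And>n. 0 \<le> \<delta> n" "\<And>n. 2 * \<delta> n \<le> b - a"
  shows "(\<lambda>n. bump (real n) (a + \<delta> n) (b - \<delta> n) x) \<longlonglongrightarrow> indicator {a<..<b} x"
proof (cases "x \<in> {a<..<b}")
  case True
  define s where "s = (\<lambda>n. max 0 ((x - (a + \<delta> n)) * (b - \<delta> n - x)))"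
  have "s \<longlonglongrightarrow> max 0 ((x - (a + 0)) * (b - 0 - x))"
    unfolding s_def by (intro tendsto_intros \<delta>)
  moreover have pos: "0 < (x - a) * (b - x)" using True by simp
  ultimately have s: "s \<longlonglongrightarrow> (x - a) * (b - x)" by (simp add: max_def)
  have "filterlim (\<lambda>n. (s n)\<^sup>2 * real n) at_top sequentially"
    by (rule filterlim_tendsto_pos_mult_at_top[OF tendsto_power[OF s, of 2] _ filterlim_real_sequentially])
       (rule zero_less_power[OF pos])
  hence "filterlim (\<lambda>n. 1 + (s n)\<^sup>2 * real n) at_infinity sequentially"
    by (intro filterlim_at_top_imp_at_infinity filterlim_tendsto_add_at_top[OF tendsto_const])
  from tendsto_inverse_0[THEN filterlim_compose, OF this]
  have "(\<lambda>n. 1 - inverse (1 + (s n)\<^sup>2 * real n)) \<longlonglongrightarrow> 1 - 0" by (intro tendsto_intros)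
  moreover have "bump (real n) (a + \<delta> n) (b - \<delta> n) x = 1 - inverse (1 + (s n)\<^sup>2 * real n)" for n
  proof -
    have "0 < 1 + (s n)\<^sup>2 * real n" by (simp add: add_pos_nonneg)
    moreover have "bump (real n) (a + \<delta> n) (b - \<delta> n) x = real n * (s n)\<^sup>2 / (1 + real n * (s n)\<^sup>2)"
      by (simp only: bump_def s_def)
    ultimately show ?thesis by (simp add: field_simps)
  qed
  ultimately show ?thesis using True by simp
next
  case False
  have "bump (real n) (a + \<delta> n) (b - \<delta> n) x = 0" for n
    using False \<delta>(2,3)[of n] by (intro bump_eq_0) auto
  thus ?thesis using False by simp
qed

text \<open>Bumps converge boundedly to the indicator of (c, L), so dominated convergence turns
  orthogonality to test functions into vanishing of all tail integrals.\<close>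

lemma du_Bois_Reymond:
  assumes u: "set_integrable lebesgue {0..L} u"
    and orth: "\<And>\<phi>. test_function L \<phi> \<Longrightarrow> (LINT x:{0..L}|lebesgue. u x * \<phi> x) = 0"
  shows "AE x in lebesgue. x \<in> {0..L} \<longrightarrow> u x = 0"
proof -
  let ?v = "\<lambda>x. indicator {0..L} x * u x"
  have iv: "integrable lebesgue ?v" using u by (simp add: set_integrable_def)
  have "(LINT x:{a<..}|lebesgue. ?v x) = 0" for a
  proof -
    \<comment> \<open>The extension of u by zero vanishes left of 0, so starting at max a 0 changes
      the tail at most in the single point 0, and the bumps stay inside (0, L).\<close>
    define c where "c = max a 0"
    have null: "AE x in lebesgue. x \<noteq> L" by (intro AE_completion AE_lborel_singleton)
    show ?thesis
    proof (cases "c < L")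
      case False
      have "AE x in lebesgue. indicator {a<..} x *\<^sub>R ?v x = 0"
        using null by eventually_elim (use False in \<open>auto simp: c_def indicator_def\<close>)
      thus ?thesis unfolding set_lebesgue_integral_def by (rule integral_eq_zero_AE)
    next
      case True
      define \<delta> where "\<delta> = (\<lambda>n. (L - c) / real (n + 3))"
      have \<delta>: "\<delta> \<longlonglongrightarrow> 0" unfolding \<delta>_def by (rule LIMSEQ_ignore_initial_segment[OF lim_const_over_n])
      have \<delta>_pos: "0 < \<delta> n" "2 * \<delta> n < L - c" for n
      proof -
        show pos: "0 < \<delta> n" using True by (simp add: \<delta>_def)
        have "\<delta> n * real (n + 3) = L - c" by (simp add: \<delta>_def del: of_nat_add)
        hence "L - c = \<delta> n * real n + 3 * \<delta> n" by (simp add: algebra_simps)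
        moreover have "0 \<le> \<delta> n * real n" using pos by simp
        ultimately show "2 * \<delta> n < L - c" using pos by linarith
      qed
      define \<phi> where "\<phi> = (\<lambda>n. bump (real n) (c + \<delta> n) (L - \<delta> n))"
      have test: "test_function L (\<phi> n)" for n
        unfolding \<phi>_def using \<delta>_pos[of n] True
        by (intro test_function_bump) (auto simp: c_def max_def split: if_splits)
      have meas: "\<phi> n \<in> borel_measurable lebesgue" for n
      proof -
        have "continuous_on UNIV (\<phi> n)" using test[of n] by (simp add: test_function_def C_k_1_real_iff)
        thus ?thesis by (intro measurable_completion) (simp add: borel_measurable_continuous_onI)
      qed
      have "(\<lambda>n. LINT x|lebesgue. ?v x * \<phi> n x) \<longlonglongrightarrow> (LINT x|lebesgue. indicator {a<..} x *\<^sub>R ?v x)"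
      proof (rule integral_dominated_convergence)
        show "(\<lambda>x. indicator {a<..} x *\<^sub>R ?v x) \<in> borel_measurable lebesgue"
          using integrable_mult_indicator[OF _ iv, of "{a<..}"] by (intro borel_measurable_integrable) simp
        show "(\<lambda>x. ?v x * \<phi> n x) \<in> borel_measurable lebesgue" for n
          by (intro borel_measurable_times[OF borel_measurable_integrable[OF iv] meas])
        show "integrable lebesgue (\<lambda>x. \<bar>?v x\<bar>)" using iv by (rule integrable_abs)
        have lim: "(\<lambda>n. ?v x * \<phi> n x) \<longlonglongrightarrow> ?v x * indicator {c<..<L} x" for x
          unfolding \<phi>_def using True \<delta>_pos
          by (intro tendsto_mult tendsto_const bump_LIMSEQ \<delta>) (auto intro: less_imp_le)
        have "AE x in lebesgue. ?v x * indicator {c<..<L} x = indicator {a<..} x *\<^sub>R ?v x"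
        proof -
          have "AE x in lebesgue. x \<noteq> (0::real)" by (intro AE_completion AE_lborel_singleton)
          with null show ?thesis by eventually_elim (auto simp: c_def indicator_def)
        qed
        thus "AE x in lebesgue. (\<lambda>n. ?v x * \<phi> n x) \<longlonglongrightarrow> indicator {a<..} x *\<^sub>R ?v x"
        proof eventually_elim
          case (elim x)
          show ?case using lim[of x] unfolding elim .
        qed
        show "AE x in lebesgue. norm (?v x * \<phi> n x) \<le> \<bar>?v x\<bar>" for n
          using bump_bounds[of "real n" "c + \<delta> n" "L - \<delta> n"]
          by (intro always_eventually allI) (simp add: abs_mult \<phi>_def mult_left_le)
      qed
      moreover have "(LINT x|lebesgue. ?v x * \<phi> n x) = 0" for n
        using orth[OF test[of n]] by (simp add: set_lebesgue_integral_def mult.assoc)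
      ultimately show ?thesis unfolding set_lebesgue_integral_def
        by (simp add: LIMSEQ_const_iff)
    qed
  qed
  from AE_eq_0_if_integral_Ioi_eq_0[OF iv this] show ?thesis
    by eventually_elim (auto simp: indicator_def split: if_splits)
qed

text \<open>Evaluates integrals that contain \<open>weak_deriv\<close>. Measurability of f is not
  assumed: Lebesgue measure is complete, so it is inherited from g.\<close>

lemma LINT_AE_eq_integral:
  fixes f g :: "real \<Rightarrow> real"
  assumes g: "continuous_on {a..b} g" and eq: "AE x in lebesgue. x \<in> {a..b} \<longrightarrow> f x = g x"
  shows "(LINT x:{a..b}|lebesgue. f x) = integral {a..b} g"
proof -
  have g': "(\<lambda>x. indicator {a..b} x *\<^sub>R g x) \<in> borel_measurable lebesgue"
    using absolutely_integrable_continuous_real[OF g] unfolding set_integrable_def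
    by (rule borel_measurable_integrable)
  have ae: "AE x in lebesgue. indicator {a..b} x *\<^sub>R g x = indicator {a..b} x *\<^sub>R f x"
    using eq by eventually_elim (auto simp: indicator_def)
  have "(LINT x:{a..b}|lebesgue. f x) = (LINT x:{a..b}|lebesgue. g x)"
    unfolding set_lebesgue_integral_def using ae
    by (intro integral_cong_AE borel_measurable_AE[OF g' ae] g') (auto elim!: eventually_mono)
  thus ?thesis using LINT_continuous_eq_integral[OF g] by simp
qed

lemma in_L2_continuous:
  assumes "continuous_on {0..L} u"
  shows "in_L2 L u"
  unfolding in_L2_def
proof
  show "set_borel_measurable lebesgue {0..L} u"
    using absolutely_integrable_continuous_real[OF assms]
    unfolding set_borel_measurable_def set_integrable_def by (rule borel_measurable_integrable)
  show "set_integrable lebesgue {0..L} (\<lambda>x. (u x)\<^sup>2)"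
    by (intro absolutely_integrable_continuous_real continuous_intros assms)
qed

text \<open>On a bounded interval the function 1 + u^2 is an integrable majorant.\<close>

lemma in_L2_imp_set_integrable:
  assumes "in_L2 L u"
  shows "set_integrable lebesgue {0..L} u"
proof (rule set_integrable_bound)
  show "set_integrable lebesgue {0..L} (\<lambda>x. 1 + (u x)\<^sup>2)"
    using assms
    by (intro set_integral_add(1) absolutely_integrable_continuous_real[OF continuous_on_const])
       (simp add: in_L2_def)
  show "set_borel_measurable lebesgue {0..L} u" using assms by (simp add: in_L2_def)
  show "AE x in lebesgue. x \<in> {0..L} \<longrightarrow> norm (u x) \<le> norm (1 + (u x)\<^sup>2)"
  proof (intro always_eventually allI impI)
    fix x
    have "0 \<le> (\<bar>u x\<bar> - 1)\<^sup>2" by simp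
    hence "2 * \<bar>u x\<bar> \<le> 1 + (u x)\<^sup>2" by (simp add: power2_diff)
    thus "norm (u x) \<le> norm (1 + (u x)\<^sup>2)" using abs_ge_zero[of "u x"] by (simp add: abs_of_nonneg)
  qed
qed

lemma set_integrable_mult_continuous:
  fixes u \<phi> :: "real \<Rightarrow> real"
  assumes u: "set_integrable lebesgue {0..L} u" and \<phi>: "continuous_on UNIV \<phi>"
  shows "set_integrable lebesgue {0..L} (\<lambda>x. u x * \<phi> x)"
proof -
  have "bounded (\<phi> ` {0..L})"
    by (intro compact_imp_bounded compact_continuous_image continuous_on_subset[OF \<phi>] compact_Icc)
       simp
  then obtain B where B: "\<forall>x\<in>{0..L}. \<bar>\<phi> x\<bar> \<le> B" unfolding bounded_iff by auto
  have m: "\<phi> \<in> borel_measurable lebesgue"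
    using \<phi> by (intro measurable_completion) (simp add: borel_measurable_continuous_onI)
  show ?thesis
  proof (rule set_integrable_bound)
    show "set_integrable lebesgue {0..L} (\<lambda>x. B * u x)" using u by simp
    show "set_borel_measurable lebesgue {0..L} (\<lambda>x. u x * \<phi> x)"
      using borel_measurable_times[OF borel_measurable_integrable[OF u[unfolded set_integrable_def]] m]
      by (simp add: set_borel_measurable_def mult.assoc)
    show "AE x in lebesgue. x \<in> {0..L} \<longrightarrow> norm (u x * \<phi> x) \<le> norm (B * u x)"
    proof (intro always_eventually allI impI)
      fix x assume "x \<in> {0..L}"
      hence "\<bar>\<phi> x\<bar> \<le> \<bar>B\<bar>" using B by fastforce
      hence "\<bar>u x\<bar> * \<bar>\<phi> x\<bar> \<le> \<bar>u x\<bar> * \<bar>B\<bar>" by (rule mult_left_mono) simp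
      thus "norm (u x * \<phi> x) \<le> norm (B * u x)" by (simp add: abs_mult mult.commute)
    qed
  qed
qed

section \<open>Classical and weak derivatives of C^1 functions on [0, L]\<close>

locale C1_profile =
  fixes L :: real and u u' :: "real \<Rightarrow> real"
  assumes deriv: "\<And>x. x \<in> {0..L} \<Longrightarrow> (u has_real_derivative u' x) (at x within {0..L})"
    and cont_deriv: "continuous_on {0..L} u'"
begin

lemma cont: "continuous_on {0..L} u"
  by (rule DERIV_continuous_on) (rule deriv)

lemma has_weak_deriv: "has_weak_deriv L u u'"
  unfolding has_weak_deriv_def
proof (intro allI impI)
  fix \<phi> assume \<phi>: "test_function L \<phi>"
  then obtain \<phi>' where \<phi>': "continuous_on UNIV \<phi>'" "\<And>x. (\<phi> has_real_derivative \<phi>' x) (at x)"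
    and c: "continuous_on UNIV \<phi>"
    unfolding test_function_def C_k_1_real_iff by auto
  have supp: "closure {x. \<phi> x \<noteq> 0} \<subseteq> {0<..<L}" using \<phi> by (simp add: test_function_def)
  have bc: "\<phi> 0 = 0" "\<phi> L = 0" using supp closure_subset[of "{x. \<phi> x \<noteq> 0}"] by auto
  have [simp]: "deriv \<phi> = \<phi>'" using \<phi>'(2) DERIV_imp_deriv by blast
  have c': "continuous_on {0..L} \<phi>" "continuous_on {0..L} \<phi>'"
    using c \<phi>'(1) continuous_on_subset by blast+
  have "integral {0..L} (\<lambda>x. u x * \<phi>' x) + integral {0..L} (\<lambda>x. u' x * \<phi> x) = 0"
  proof (cases "0 \<le> L")
    case True
    have "((\<lambda>x. u x * \<phi>' x + u' x * \<phi> x) has_integral u L * \<phi> L - u 0 * \<phi> 0) {0..L}"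
    proof (rule fundamental_theorem_of_calculus[OF True])
      fix x assume "x \<in> {0..L}"
      from DERIV_mult'[OF deriv[OF this] has_field_derivative_at_within[OF \<phi>'(2)]]
      show "((\<lambda>x. u x * \<phi> x) has_vector_derivative u x * \<phi>' x + u' x * \<phi> x) (at x within {0..L})"
        unfolding has_real_derivative_iff_has_vector_derivative .
    qed
    hence "integral {0..L} (\<lambda>x. u x * \<phi>' x + u' x * \<phi> x) = 0"
      by (simp add: integral_unique bc)
    thus ?thesis
      by (subst (asm) integral_add)
         (auto intro!: integrable_continuous_real continuous_intros cont cont_deriv c')
  qed simp
  thus "(LINT x:{0..L}|lebesgue. u x * deriv \<phi> x) = - (LINT x:{0..L}|lebesgue. u' x * \<phi> x)"
    by (simp add: LINT_continuous_eq_integral continuous_intros cont cont_deriv c')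
qed

lemma in_H1: "in_H1 L u"
  unfolding in_H1_def using in_L2_continuous cont cont_deriv has_weak_deriv by blast

text \<open>The chosen weak derivative and u' satisfy the same integration by parts, so their
  difference is orthogonal to every test function and vanishes almost everywhere.\<close>

lemma weak_deriv_AE: "AE x in lebesgue. x \<in> {0..L} \<longrightarrow> weak_deriv L u x = u' x"
proof -
  define w where "w = weak_deriv L u"
  have "in_L2 L w \<and> has_weak_deriv L u w"
    unfolding w_def weak_deriv_def
    by (rule someI[of _ u']) (simp add: in_L2_continuous cont_deriv has_weak_deriv)
  hence w: "in_L2 L w" "has_weak_deriv L u w" by auto
  have i: "set_integrable lebesgue {0..L} w" "set_integrable lebesgue {0..L} u'"
    using w cont_deriv in_L2_continuous by (auto intro: in_L2_imp_set_integrable)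
  have "AE x in lebesgue. x \<in> {0..L} \<longrightarrow> w x - u' x = 0"
  proof (rule du_Bois_Reymond)
    show "set_integrable lebesgue {0..L} (\<lambda>x. w x - u' x)" using i by (rule set_integral_diff)
    fix \<phi> assume \<phi>: "test_function L \<phi>"
    hence c: "continuous_on UNIV \<phi>" by (simp add: test_function_def)
    have "(LINT x:{0..L}|lebesgue. (w x - u' x) * \<phi> x) =
        (LINT x:{0..L}|lebesgue. w x * \<phi> x) - (LINT x:{0..L}|lebesgue. u' x * \<phi> x)"
      using set_integral_diff(2)[OF i[THEN set_integrable_mult_continuous[OF _ c]]]
      by (simp add: left_diff_distrib)
    also have "\<dots> = 0"
      using w(2) has_weak_deriv \<phi> unfolding has_weak_deriv_def by simp
    finally show "(LINT x:{0..L}|lebesgue. (w x - u' x) * \<phi> x) = 0" .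
  qed
  thus ?thesis by (simp add: w_def)
qed

end

subsection \<open>Height profiles and the energy functionals\<close>

text \<open>The smooth function with \<open>G = sgn (y - h\<^sup>*) G_abs\<close>: bounding it instead of \<open>G\<close> avoids the
  derivative of \<open>G\<close> at \<open>h\<^sup>*\<close>.\<close>

definition G_abs :: "real \<Rightarrow> real \<Rightarrow> real" where
  "G_abs hs y = 2/3 * y * sqrt y - 2 * hs * sqrt y + 4/3 * hs * sqrt hs"

lemma G_fun_eq: "G_fun hs y = sgn (y - hs) * G_abs hs y"
  by (simp add: G_fun_def G_abs_def)

lemma abs_G_fun_le: "\<bar>G_fun hs y\<bar> \<le> \<bar>G_abs hs y\<bar>"
  by (simp add: G_fun_eq abs_mult sgn_if)

lemma G_abs_self: "G_abs hs hs = 0"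
  by (simp add: G_abs_def)

lemma DERIV_G_abs:
  assumes "y > 0"
  shows "(G_abs hs has_real_derivative (y - hs) / sqrt y) (at y)"
proof -
  have s: "sqrt y > 0" "y = sqrt y * sqrt y" using assms by auto
  have "(G_abs hs has_real_derivative
      2/3 * (sqrt y + y * (inverse (sqrt y) / 2)) - 2 * hs * (inverse (sqrt y) / 2)) (at y)"
    unfolding G_abs_def
    by (rule derivative_eq_intros DERIV_real_sqrt refl assms | simp add: field_simps)+
  also have "2/3 * (sqrt y + y * (inverse (sqrt y) / 2)) - 2 * hs * (inverse (sqrt y) / 2)
      = (y - hs) / sqrt y"
  proof -
    have "y * inverse (sqrt y) = sqrt y" using s by (simp add: field_simps)
    moreover have "(y - hs) / sqrt y = y * inverse (sqrt y) - hs * inverse (sqrt y)"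
      by (simp add: divide_inverse algebra_simps)
    ultimately show ?thesis by simp
  qed
  finally show ?thesis .
qed

lemma continuous_on_G_abs: "continuous_on A (G_abs hs)"
  unfolding G_abs_def[abs_def] by (intro continuous_intros)

text \<open>\<open>G_abs\<close> decreases up to its zero at hs and increases afterwards; the sign
  factor reflects the left branch.\<close>

lemma G_fun_strict_mono:
  assumes "0 < hs" "0 < x" "x < y"
  shows "G_fun hs x < G_fun hs y"
proof -
  have up: "G_abs hs a < G_abs hs b" if "hs \<le> a" "a < b" for a b
    by (rule DERIV_pos_imp_increasing_open[OF that(2) _ continuous_on_G_abs])
       (use that assms in \<open>fastforce intro!: DERIV_G_abs divide_pos_pos\<close>)
  have down: "G_abs hs b < G_abs hs a" if "0 < a" "b \<le> hs" "a < b" for a b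
    by (rule DERIV_neg_imp_decreasing_open[OF that(3) _ continuous_on_G_abs])
       (use that assms in \<open>fastforce intro!: DERIV_G_abs divide_neg_pos\<close>)
  consider "hs \<le> x" | "y \<le> hs" | "x < hs" "hs < y" by linarith
  thus ?thesis
  proof cases
    case 1 thus ?thesis using up[of x y] assms by (auto simp: G_fun_eq sgn_if G_abs_self)
  next
    case 2 thus ?thesis using down[of x y] assms by (auto simp: G_fun_eq sgn_if G_abs_self)
  next
    case 3 thus ?thesis
      using up[of hs y] down[of x hs] assms by (auto simp: G_fun_eq sgn_if G_abs_self)
  qed
qed

text \<open>Only values -c r with r nonnegative are ever inverted, so the branch below hs suffices.
  The intermediate value theorem works on the closed interval [0, hs]; the strict lower bound on z
  excludes the endpoint 0.\<close>

lemma G_inv_nonpos: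
  assumes hs: "0 < hs" and z: "- (4/3 * hs * sqrt hs) < z" "z \<le> 0"
  shows "0 < G_inv hs z" "G_fun hs (G_inv hs z) = z"
proof -
  have "\<exists>y\<ge>0. y \<le> hs \<and> - G_abs hs y = z"
    by (rule IVT') (use hs z in \<open>auto simp: G_abs_self G_abs_def[of _ 0]
        intro!: continuous_intros continuous_on_G_abs\<close>)
  then obtain y where y: "0 \<le> y" "y \<le> hs" "- G_abs hs y = z" by blast
  moreover have "y \<noteq> 0" using y z by (auto simp: G_abs_def)
  ultimately have y': "0 < y" "G_fun hs y = z"
    by (auto simp: G_fun_eq sgn_if G_abs_self)
  have "inj_on (G_fun hs) {0<..}"
    by (rule inj_onI) (metis G_fun_strict_mono greaterThan_iff hs less_irrefl linorder_less_linear)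
  hence "G_inv hs z = y" unfolding G_inv_def using y' by (intro the_inv_into_f_eq) auto
  thus "0 < G_inv hs z" "G_fun hs (G_inv hs z) = z" using y' by auto
qed

text \<open>Explains \<open>R_const\<close>: c R is exactly the smaller of G(H) and 4/3 hs sqrt hs.
  The first bound prevents the height from exceeding H, the second keeps -c r inside the range of G,
  whose infimum is -4/3 hs sqrt hs.\<close>

lemma c_R_le:
  assumes "0 < g" "0 < \<mu>" "0 < hs" "hs < H"
  shows "c_const g \<mu> * R_const g \<mu> hs H \<le> G_fun hs H"
    and "c_const g \<mu> * R_const g \<mu> hs H \<le> 4/3 * hs * sqrt hs"
proof -
  have eq: "c_const g \<mu> * R_const g \<mu> hs H = 2/3 * (2 * hs * sqrt hs + sqrt H * min (H - 3 * hs) 0)"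
    using assms by (simp add: c_const_def R_const_def)
  have "sqrt H * min (H - 3 * hs) 0 \<le> sqrt H * (H - 3 * hs)"
    using assms by (intro mult_left_mono) auto
  thus "c_const g \<mu> * R_const g \<mu> hs H \<le> G_fun hs H"
    unfolding eq using assms by (simp add: G_fun_def algebra_simps)
  have "sqrt H * min (H - 3 * hs) 0 \<le> sqrt H * 0"
    using assms by (intro mult_left_mono) auto
  thus "c_const g \<mu> * R_const g \<mu> hs H \<le> 4/3 * hs * sqrt hs" unfolding eq by simp
qed

section \<open>Energy functionals and inequalities for a single height and velocity profile\<close>

locale profile = C1_profile L h hx for L :: real and h hx :: "real \<Rightarrow> real" +
  fixes g \<mu> m :: real and v :: "real \<Rightarrow> real"
  assumes L: "0 < L" and g: "0 < g" and \<mu>: "0 < \<mu>" and m: "0 < m"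
    and cont_v: "continuous_on {0..L} v"
    and h_pos: "\<And>x. x \<in> {0..L} \<Longrightarrow> 0 < h x"
    and mass: "integral {0..L} h = m"
begin

abbreviation "hs \<equiv> m / L"
abbreviation "Kin \<equiv> integral {0..L} (\<lambda>x. h x * (v x)\<^sup>2)"
abbreviation "Mix \<equiv> integral {0..L} (\<lambda>x. inverse (h x) * (h x * v x + \<mu> * hx x)\<^sup>2)"
abbreviation "Dev \<equiv> integral {0..L} (\<lambda>x. (h x - hs)\<^sup>2)"
abbreviation "Slope \<equiv> integral {0..L} (\<lambda>x. (hx x)\<^sup>2)"
abbreviation "Vel \<equiv> integral {0..L} (\<lambda>x. (v x)\<^sup>2)"

lemma h_nz: "x \<in> {0..L} \<Longrightarrow> h x \<noteq> 0" using h_pos by force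

lemmas conts = continuous_intros cont cont_deriv cont_v

lemma int_Mix: "(\<lambda>x. inverse (h x) * (h x * v x + \<mu> * hx x)\<^sup>2) integrable_on {0..L}"
  by (intro integrable_continuous_real conts) (use h_nz in auto)

lemma int_Kin: "(\<lambda>x. h x * (v x)\<^sup>2) integrable_on {0..L}"
  by (intro integrable_continuous_real conts)

lemma int_Dev: "(\<lambda>x. (h x - hs)\<^sup>2) integrable_on {0..L}"
  by (intro integrable_continuous_real conts)

lemma int_Slope: "(\<lambda>x. (hx x)\<^sup>2) integrable_on {0..L}"
  by (intro integrable_continuous_real conts)

lemma int_Vel: "(\<lambda>x. (v x)\<^sup>2) integrable_on {0..L}"
  by (intro integrable_continuous_real conts)

lemma hs_pos: "0 < hs" using m L by simp

lemma E_fun_eq: "E_fun L g hs h v = 1/2 * Kin + 1/2 * g * Dev"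
  unfolding E_fun_def by (subst (1 2) LINT_continuous_eq_integral) (intro conts refl)+

lemma W_fun_eq: "W_fun L g \<mu> hs h v = 1/2 * Mix + 1/2 * g * Dev"
proof -
  have "(LINT x:{0..L}|lebesgue. inverse (h x) * (h x * v x + \<mu> * weak_deriv L h x)\<^sup>2) = Mix"
  proof (rule LINT_AE_eq_integral)
    show "continuous_on {0..L} (\<lambda>x. inverse (h x) * (h x * v x + \<mu> * hx x)\<^sup>2)"
      by (intro conts) (use h_nz in auto)
    show "AE x in lebesgue. x \<in> {0..L} \<longrightarrow> inverse (h x) * (h x * v x + \<mu> * weak_deriv L h x)\<^sup>2
        = inverse (h x) * (h x * v x + \<mu> * hx x)\<^sup>2"
      using weak_deriv_AE by eventually_elim auto
  qed
  moreover have "(LINT x:{0..L}|lebesgue. (h x - hs)\<^sup>2) = Dev"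
    by (intro LINT_continuous_eq_integral conts)
  ultimately show ?thesis unfolding W_fun_def by simp
qed

lemma L2_norm_eqs:
  "(L2_norm L v)\<^sup>2 = Vel" "(L2_norm L (\<lambda>x. h x - hs))\<^sup>2 = Dev"
  "(L2_norm L (weak_deriv L (\<lambda>x. h x - hs)))\<^sup>2 = Slope"
proof -
  interpret d: C1_profile L "\<lambda>x. h x - hs" hx
    by unfold_locales (auto intro!: derivative_eq_intros deriv cont_deriv)
  have "(LINT x:{0..L}|lebesgue. \<bar>weak_deriv L (\<lambda>x. h x - hs) x\<bar>\<^sup>2) = Slope"
  proof (rule LINT_AE_eq_integral)
    show "AE x in lebesgue. x \<in> {0..L} \<longrightarrow> \<bar>weak_deriv L (\<lambda>x. h x - hs) x\<bar>\<^sup>2 = (hx x)\<^sup>2"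
      using d.weak_deriv_AE by eventually_elim auto
  qed (intro conts)
  moreover have "(LINT x:{0..L}|lebesgue. \<bar>v x\<bar>\<^sup>2) = Vel"
    by (simp add: LINT_continuous_eq_integral conts)
  moreover have "(LINT x:{0..L}|lebesgue. \<bar>h x - hs\<bar>\<^sup>2) = Dev"
    by (simp add: LINT_continuous_eq_integral conts)
  ultimately show "(L2_norm L v)\<^sup>2 = Vel" "(L2_norm L (\<lambda>x. h x - hs))\<^sup>2 = Dev"
    "(L2_norm L (weak_deriv L (\<lambda>x. h x - hs)))\<^sup>2 = Slope"
    unfolding L2_norm_def by (simp_all add: integral_nonneg int_Slope int_Vel int_Dev)
qed

lemma in_S_set: "v 0 = 0 \<Longrightarrow> v L = 0 \<Longrightarrow> (\<xi>, w, h, v) \<in> S_set L m"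
  unfolding S_set_def using cont h_pos in_H1 cont_v mass LINT_continuous_eq_integral[OF cont] by simp

text \<open>Rolle's theorem for the primitive of h - hs, which vanishes at both ends because the
  mass is m. This provides a point from which deviations of h, and G(h), can be measured.\<close>

lemma attains_mean: "\<exists>y\<in>{0..L}. h y = hs"
proof -
  define H where "H = (\<lambda>x. integral {0..x} h - hs * x)"
  have H: "(H has_real_derivative h x - hs) (at x within {0..L})" if "x \<in> {0..L}" for x
    unfolding H_def
    by (rule derivative_eq_intros integral_has_real_derivative[OF cont that] refl | simp)+
  have "\<exists>z. 0 < z \<and> z < L \<and> (\<lambda>v. v * (h z - hs)) = (\<lambda>v. 0)"
  proof (rule Rolle_deriv[OF L])
    show "H 0 = H L" using L mass by (simp add: H_def)
    show "continuous_on {0..L} H" by (rule DERIV_continuous_on) (rule H)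
    fix x assume x: "0 < x" "x < L"
    hence "(H has_real_derivative h x - hs) (at x)"
      using H[of x] at_within_interior[of x "{0..L}"] by (simp add: interior_atLeastAtMost_real)
    thus "(H has_derivative (\<lambda>v. v * (h x - hs))) (at x)"
      by (simp add: has_field_derivative_def mult_commute_abs)
  qed
  then obtain z where z: "0 < z" "z < L" "(\<lambda>v. v * (h z - hs)) = (\<lambda>v. 0)" by blast
  from fun_cong[OF z(3), of 1] show ?thesis using z by (intro bexI[of _ z]) auto
qed

lemma deviation_le: "x \<in> {0..L} \<Longrightarrow> (h x - hs)\<^sup>2 \<le> L * Slope"
  using attains_mean increment_square_le[OF deriv cont_deriv] by fastforce

lemma Dev_le: "Dev \<le> L\<^sup>2 * Slope"
proof -
  have "Dev \<le> integral {0..L} (\<lambda>x. L * Slope)"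
    by (intro integral_le int_Dev deviation_le) auto
  thus ?thesis using L by (simp add: power2_eq_square)
qed

lemma momentum_le: "(integral {0..L} (\<lambda>x. h x * v x))\<^sup>2 \<le> m * Kin"
  using integral_weighted_Cauchy_Schwarz[OF cont cont_v] h_pos mass m by (simp add: less_imp_le)

lemma end_difference_le: "(h L - h 0)\<^sup>2 \<le> L * Slope"
  using increment_square_le[OF deriv cont_deriv, of L 0] L by simp

text \<open>For fixed h and slope the sum is quadratic in v, with minimum at h v = - mu h_x / 2; the
  remainder is the completed square. Thus E and W together control the slope although neither
  contains it alone.\<close>

lemma slope_density_le:
  assumes "x \<in> {0..L}"
  shows "1/4 * \<mu>\<^sup>2 * (hx x)\<^sup>2 / h x
    \<le> 1/2 * (h x * (v x)\<^sup>2 + inverse (h x) * (h x * v x + \<mu> * hx x)\<^sup>2)"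
proof -
  have "0 \<le> (2 * h x * v x + \<mu> * hx x)\<^sup>2 / (4 * h x)"
    using h_pos[OF assms] by simp
  also have "\<dots> = 1/2 * (h x * (v x)\<^sup>2 + inverse (h x) * (h x * v x + \<mu> * hx x)\<^sup>2)
      - 1/4 * \<mu>\<^sup>2 * (hx x)\<^sup>2 / h x"
    using h_pos[OF assms] by (simp add: field_simps power2_eq_square)
  finally show ?thesis by simp
qed

lemma G_fun_le:
  assumes x: "x \<in> {0..L}"
  shows "\<bar>G_fun hs (h x)\<bar> \<le> c_const g \<mu> * (W_fun L g \<mu> hs h v + E_fun L g hs h v)"
proof -
  define e where "e = (\<lambda>x. c_const g \<mu> *
    (1/2 * (h x * (v x)\<^sup>2 + inverse (h x) * (h x * v x + \<mu> * hx x)\<^sup>2) + g * (h x - hs)\<^sup>2))"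
  define G' where "G' = (\<lambda>x. (h x - hs) / sqrt (h x) * hx x)"
  have c: "0 < c_const g \<mu>" using g \<mu> by (simp add: c_const_def)
  have e0: "0 \<le> e x" if "x \<in> {0..L}" for x
    unfolding e_def using c g h_pos[OF that] by (intro mult_nonneg_nonneg add_nonneg_nonneg) auto
  have cont_e: "continuous_on {0..L} e"
    unfolding e_def by (intro conts) (use h_nz in auto)
  have cont_G': "continuous_on {0..L} G'"
    unfolding G'_def by (intro conts) (use h_nz in auto)
  have dG: "((\<lambda>x. G_abs hs (h x)) has_real_derivative G' x) (at x within {0..L})"
    if "x \<in> {0..L}" for x
    unfolding G'_def by (rule DERIV_chain2[OF DERIV_G_abs[OF h_pos[OF that]] deriv[OF that]])
  have bound: "\<bar>G' x\<bar> \<le> e x" if "x \<in> {0..L}" for x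
  proof -
    define s where "s = sqrt (h x)"
    have s: "0 < s" "h x = s\<^sup>2" using h_pos[OF that] by (auto simp: s_def)
    \<comment> \<open>With this splitting 2 a b equals mu sqrt g times the modulus of
      \<open>G'\<close>; this is where c = 1 / (mu sqrt g) comes from. The sum a^2 + b^2 is what the
      two energy densities dominate.\<close>
    define a where "a = \<mu> * \<bar>hx x\<bar> / (2 * s)"
    define b where "b = sqrt g * \<bar>h x - hs\<bar>"
    have "c_const g \<mu> * (2 * a * b) = \<bar>h x - hs\<bar> / s * \<bar>hx x\<bar>"
      using s(1) g \<mu> unfolding a_def b_def c_const_def by (simp add: divide_simps)
    hence "\<bar>G' x\<bar> = c_const g \<mu> * (2 * a * b)"
      using s(1) by (simp add: G'_def s_def[symmetric] abs_mult)
    also have "\<dots> \<le> c_const g \<mu> * (a\<^sup>2 + b\<^sup>2)"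
      using c sum_squares_bound[of a b] by (intro mult_left_mono) auto
    also have "a\<^sup>2 + b\<^sup>2 = 1/4 * \<mu>\<^sup>2 * (hx x)\<^sup>2 / h x + g * (h x - hs)\<^sup>2"
      using g by (simp add: a_def b_def s(2) power_mult_distrib power_divide)
    also have "c_const g \<mu> * \<dots> \<le> e x"
      unfolding e_def using c slope_density_le[OF that] by (intro mult_left_mono) auto
    finally show ?thesis .
  qed
  have int_e: "integral {0..L} e = c_const g \<mu> * (W_fun L g \<mu> hs h v + E_fun L g hs h v)"
  proof -
    have "(e has_integral c_const g \<mu> * (1/2 * (Kin + Mix) + g * Dev)) {0..L}"
      unfolding e_def
      by (intro has_integral_mult_right has_integral_add integrable_integral int_Kin int_Mix int_Dev)
    thus ?thesis by (simp add: integral_unique W_fun_eq E_fun_eq algebra_simps)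
  qed
  have diff: "\<bar>G_abs hs (h b) - G_abs hs (h a)\<bar> \<le> integral {0..L} e"
    if ab: "a \<le> b" "a \<in> {0..L}" "b \<in> {0..L}" for a b
  proof -
    have sub: "{a..b} \<subseteq> {0..L}" using ab by auto
    have "(G' has_integral (G_abs hs (h b) - G_abs hs (h a))) {a..b}"
    proof (rule fundamental_theorem_of_calculus[OF ab(1)])
      fix z assume "z \<in> {a..b}"
      thus "((\<lambda>x. G_abs hs (h x)) has_vector_derivative G' z) (at z within {a..b})"
        unfolding has_real_derivative_iff_has_vector_derivative[symmetric]
        using dG[of z] sub DERIV_subset by blast
    qed
    hence "\<bar>G_abs hs (h b) - G_abs hs (h a)\<bar> = norm (integral {a..b} G')"
      by (simp add: integral_unique)
    also have "\<dots> \<le> integral {a..b} e"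
      using sub bound
      by (intro integral_norm_bound_integral integrable_continuous_real
          continuous_on_subset[OF cont_G'] continuous_on_subset[OF cont_e]) auto
    also have "\<dots> \<le> integral {0..L} e"
      using e0 by (intro integral_subset_le sub integrable_continuous_real cont_e
          continuous_on_subset[OF cont_e sub]) auto
    finally show ?thesis .
  qed
  \<comment> \<open>\<open>G_abs\<close> vanishes at this point, so the increment bound becomes a
    bound on the value itself.\<close>
  obtain y where y: "y \<in> {0..L}" "h y = hs" using attains_mean by blast
  have "\<bar>G_abs hs (h x)\<bar> \<le> integral {0..L} e"
    using diff[of x y] diff[of y x] x y G_abs_self[of hs] by (cases "x \<le> y") auto
  thus ?thesis using abs_G_fun_le[of hs "h x"] int_e by linarith
qed

end

section \<open>Comparison of the energies with the norms under two-sided height bounds\<close>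

locale bounded_profile = profile +
  fixes h1 H :: real
  assumes h1: "0 < h1" and h_ge: "\<And>x. x \<in> {0..L} \<Longrightarrow> h1 \<le> h x"
    and h_le: "\<And>x. x \<in> {0..L} \<Longrightarrow> h x \<le> H"
begin

lemma H_pos: "0 < H" using h_ge[of 0] h_le[of 0] h1 L by force

lemma Kin_le: "Kin \<le> H * Vel"
proof -
  have "Kin \<le> integral {0..L} (\<lambda>x. H * (v x)\<^sup>2)"
    by (intro integral_le int_Kin integrable_continuous_real conts mult_right_mono h_le) auto
  thus ?thesis by simp
qed

lemma Kin_ge: "h1 * Vel \<le> Kin"
proof -
  have "integral {0..L} (\<lambda>x. h1 * (v x)\<^sup>2) \<le> Kin"
    by (intro integral_le int_Kin integrable_continuous_real conts mult_right_mono h_ge) auto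
  thus ?thesis by simp
qed

lemma Mix_le: "Mix \<le> 2 * Kin + 2 * \<mu>\<^sup>2 / h1 * Slope"
proof -
  have "Mix \<le> integral {0..L} (\<lambda>x. 2 * (h x * (v x)\<^sup>2) + 2 * \<mu>\<^sup>2 / h1 * (hx x)\<^sup>2)"
  proof (rule integral_le[OF int_Mix])
    show "(\<lambda>x. 2 * (h x * (v x)\<^sup>2) + 2 * \<mu>\<^sup>2 / h1 * (hx x)\<^sup>2) integrable_on {0..L}"
      by (intro integrable_continuous_real conts) (use h1 in auto)
    fix x assume x: "x \<in> {0..L}"
    have "inverse (h x) * (h x * v x + \<mu> * hx x)\<^sup>2
        \<le> inverse (h x) * (2 * (h x * v x)\<^sup>2 + 2 * (\<mu> * hx x)\<^sup>2)"
      using h_pos[OF x] sum_squares_bound[of "h x * v x" "\<mu> * hx x"]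
      by (intro mult_left_mono) (auto simp: power2_sum)
    also have "\<dots> = 2 * (h x * (v x)\<^sup>2) + 2 * \<mu>\<^sup>2 / h x * (hx x)\<^sup>2"
      using h_pos[OF x] by (simp add: field_simps power2_eq_square)
    also have "2 * \<mu>\<^sup>2 / h x * (hx x)\<^sup>2 \<le> 2 * \<mu>\<^sup>2 / h1 * (hx x)\<^sup>2"
      using h_ge[OF x] h1 by (intro mult_right_mono divide_left_mono) auto
    finally show "inverse (h x) * (h x * v x + \<mu> * hx x)\<^sup>2
        \<le> 2 * (h x * (v x)\<^sup>2) + 2 * \<mu>\<^sup>2 / h1 * (hx x)\<^sup>2" by simp
  qed
  also have "\<dots> = 2 * Kin + 2 * \<mu>\<^sup>2 / h1 * Slope"
    by (intro integral_unique has_integral_add has_integral_mult_right integrable_integral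
        int_Kin int_Slope)
  finally show ?thesis .
qed

lemma Mix_ge: "\<mu>\<^sup>2 / (2 * H) * Slope \<le> Kin + Mix"
proof -
  have "integral {0..L} (\<lambda>x. \<mu>\<^sup>2 / (2 * H) * (hx x)\<^sup>2)
      \<le> integral {0..L} (\<lambda>x. h x * (v x)\<^sup>2 + inverse (h x) * (h x * v x + \<mu> * hx x)\<^sup>2)"
  proof (rule integral_le)
    show "(\<lambda>x. \<mu>\<^sup>2 / (2 * H) * (hx x)\<^sup>2) integrable_on {0..L}"
      by (intro integrable_continuous_real conts) (use H_pos in auto)
    show "(\<lambda>x. h x * (v x)\<^sup>2 + inverse (h x) * (h x * v x + \<mu> * hx x)\<^sup>2) integrable_on {0..L}"
      by (intro integrable_add int_Kin int_Mix)
    fix x assume x: "x \<in> {0..L}"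
    have "\<mu>\<^sup>2 / (2 * H) * (hx x)\<^sup>2 \<le> \<mu>\<^sup>2 / (2 * h x) * (hx x)\<^sup>2"
      using h_pos[OF x] h_le[OF x] by (intro mult_right_mono divide_left_mono) auto
    also have "\<dots> \<le> h x * (v x)\<^sup>2 + inverse (h x) * (h x * v x + \<mu> * hx x)\<^sup>2"
      using slope_density_le[OF x] by (simp add: field_simps)
    finally show "\<mu>\<^sup>2 / (2 * H) * (hx x)\<^sup>2
        \<le> h x * (v x)\<^sup>2 + inverse (h x) * (h x * v x + \<mu> * hx x)\<^sup>2" .
  qed
  also have "\<dots> = Kin + Mix" by (intro integral_add int_Kin int_Mix)
  finally show ?thesis by simp
qed

text \<open>Wirtinger's inequality carries no weight, so h is replaced by H in the kinetic energy
  and by h1 in the viscous dissipation. The resulting quotient H / h1 is the origin of the same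
  quotient in b / h1.\<close>

lemma Kin_le_dissipation:
  assumes vx: "\<And>x. x \<in> {0..L} \<Longrightarrow> (v has_real_derivative vx x) (at x within {0..L})"
    and cvx: "continuous_on {0..L} vx" and bc: "v 0 = 0" "v L = 0"
  shows "Kin \<le> H * L\<^sup>2 / (pi\<^sup>2 * h1) * integral {0..L} (\<lambda>x. h x * (vx x)\<^sup>2)"
proof -
  have "h1 * integral {0..L} (\<lambda>x. (vx x)\<^sup>2) = integral {0..L} (\<lambda>x. h1 * (vx x)\<^sup>2)" by simp
  also have "\<dots> \<le> integral {0..L} (\<lambda>x. h x * (vx x)\<^sup>2)"
    by (intro integral_le integrable_continuous_real conts cvx mult_right_mono h_ge) auto
  finally have 1: "integral {0..L} (\<lambda>x. (vx x)\<^sup>2) \<le> integral {0..L} (\<lambda>x. h x * (vx x)\<^sup>2) / h1"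
    using h1 by (simp add: field_simps)
  have "Vel \<le> L\<^sup>2 / pi\<^sup>2 * integral {0..L} (\<lambda>x. (vx x)\<^sup>2)"
    using Wirtinger_inequality[OF L vx cvx bc] L by (simp add: field_simps power_divide)
  also have "\<dots> \<le> L\<^sup>2 / pi\<^sup>2 * (integral {0..L} (\<lambda>x. h x * (vx x)\<^sup>2) / h1)"
    by (intro mult_left_mono 1) auto
  finally have "H * Vel \<le> H * (L\<^sup>2 / pi\<^sup>2 * (integral {0..L} (\<lambda>x. h x * (vx x)\<^sup>2) / h1))"
    using H_pos by (intro mult_left_mono) auto
  thus ?thesis using Kin_le by (simp add: mult_ac)
qed

end

subsection \<open>Classical solutions\<close>

lemma C_k_Suc_planeE:
  fixes u :: "real \<Rightarrow> real \<Rightarrow> real"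
  assumes "C_k (Suc n) A (\<lambda>(t, x). u t x)"
  obtains ut ux where "C_k n A (\<lambda>(t, x). ut t x)" "C_k n A (\<lambda>(t, x). ux t x)"
    "\<forall>(t, x)\<in>interior A. ((\<lambda>s. u s x) has_real_derivative ut t x) (at t)"
    "\<forall>(t, x)\<in>interior A. (u t has_real_derivative ux t x) (at x)"
proof -
  have shift: "((\<lambda>s. F (z + s)) has_real_derivative D) (at 0) \<longleftrightarrow> (F has_real_derivative D) (at z)"
    for F :: "real \<Rightarrow> real" and z D
    using DERIV_shift[of F D 0 z] by (simp add: add.commute)
  have "(1, 0) \<in> (Basis :: (real \<times> real) set)" "(0, 1) \<in> (Basis :: (real \<times> real) set)"
    by (auto simp: Basis_prod_def)
  then obtain f1 f2 where f1: "C_k n A f1"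
      "\<And>z. z \<in> interior A \<Longrightarrow>
        ((\<lambda>s. (\<lambda>(t, x). u t x) (z + s *\<^sub>R (1, 0))) has_real_derivative f1 z) (at 0)"
    and f2: "C_k n A f2"
      "\<And>z. z \<in> interior A \<Longrightarrow>
        ((\<lambda>s. (\<lambda>(t, x). u t x) (z + s *\<^sub>R (0, 1))) has_real_derivative f2 z) (at 0)"
    using assms by (simp only: C_k.simps) blast
  show ?thesis
  proof (rule that[of "\<lambda>t x. f1 (t, x)" "\<lambda>t x. f2 (t, x)"])
    show "\<forall>(t, x)\<in>interior A. ((\<lambda>s. u s x) has_real_derivative f1 (t, x)) (at t)"
      using f1(2) by (force simp: shift[of "\<lambda>s. u s x" for x])
    show "\<forall>(t, x)\<in>interior A. (u t has_real_derivative f2 (t, x)) (at x)"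
      using f2(2) by (force simp: shift[of "u t" for t])
  qed (use f1 f2 in simp_all)
qed

lemma C_k_imp_continuous_on: "C_k k A f \<Longrightarrow> continuous_on A f"
  by (cases k) auto

lemma DERIV_transform_on:
  assumes "(f has_field_derivative D) (at x within S)" "x \<in> S" "\<And>y. y \<in> S \<Longrightarrow> g y = f y"
  shows "(g has_field_derivative D) (at x within S)"
  using assms unfolding has_field_derivative_def by (auto intro: has_derivative_transform)

text \<open>By continuity up to the ends, u is u 0 plus the integral of u', so the one-sided
  derivatives at the ends come from differentiating the integral.\<close>

lemma has_real_derivative_within_closed:
  fixes u u' :: "real \<Rightarrow> real"
  assumes u: "continuous_on {0..L} u" and u': "continuous_on {0..L} u'"
    and d: "\<And>x. x \<in> {0<..<L} \<Longrightarrow> (u has_real_derivative u' x) (at x)" and x: "x \<in> {0..L}"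
  shows "(u has_real_derivative u' x) (at x within {0..L})"
proof -
  have "((\<lambda>x. u 0 + integral {0..x} u') has_real_derivative 0 + u' x) (at x within {0..L})"
    by (intro DERIV_add DERIV_const integral_has_real_derivative u' x)
  moreover have "u y = u 0 + integral {0..y} u'" if "y \<in> {0..L}" for y
  proof -
    have "(u' has_integral u y - u 0) {0..y}"
      using that
      by (intro fundamental_theorem_of_calculus_interior continuous_on_subset[OF u])
         (auto simp: has_real_derivative_iff_has_vector_derivative[symmetric] intro!: d)
    thus ?thesis by (simp add: integral_unique)
  qed
  ultimately show ?thesis
    using DERIV_transform_on[OF _ x] by (metis (no_types, lifting) add_0)
qed

text \<open>Write the time increment of u as an integral of ut, differentiate under that integral in
  x, and then differentiate the result in time. It reconciles the mixed derivative in the time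
  derivative of W with the one obtained from differentiating the continuity equation.\<close>

lemma mixed_partials_eq:
  fixes u ut ux utx uxt :: "real \<Rightarrow> real \<Rightarrow> real"
  assumes T: "open T" and X: "open X"
    and cut: "continuous_on (T \<times> X) (\<lambda>(t, x). ut t x)"
    and cutx: "continuous_on (T \<times> X) (\<lambda>(t, x). utx t x)"
    and dut: "\<And>t x. t \<in> T \<Longrightarrow> x \<in> X \<Longrightarrow> ((\<lambda>s. u s x) has_real_derivative ut t x) (at t)"
    and dux: "\<And>t x. t \<in> T \<Longrightarrow> x \<in> X \<Longrightarrow> (u t has_real_derivative ux t x) (at x)"
    and dutx: "\<And>t x. t \<in> T \<Longrightarrow> x \<in> X \<Longrightarrow> (ut t has_real_derivative utx t x) (at x)"
    and duxt: "\<And>t x. t \<in> T \<Longrightarrow> x \<in> X \<Longrightarrow> ((\<lambda>s. ux s x) has_real_derivative uxt t x) (at t)"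
    and t: "t \<in> T" and x: "x \<in> X"
  shows "uxt t x = utx t x"
proof -
  obtain e where e: "0 < e" "cball t e \<subseteq> T" using T t open_contains_cball by blast
  obtain d where d: "0 < d" "cball x d \<subseteq> X" using X x open_contains_cball by blast
  define I where "I = {t - e..t + e}"
  define J where "J = {x - d..x + d}"
  have IJ: "I \<subseteq> T" "J \<subseteq> X" "t \<in> interior I" "x \<in> interior J" "t \<in> I" "x \<in> J"
    using e d by (auto simp: I_def J_def cball_eq_atLeastAtMost interior_atLeastAtMost_real)
  have eq: "u s y - u (t - e) y = integral {t - e..s} (\<lambda>r. ut r y)" if "s \<in> I" "y \<in> J" for s y
  proof -
    have "((\<lambda>r. ut r y) has_integral u s y - u (t - e) y) {t - e..s}"
      using that IJ e
      by (intro fundamental_theorem_of_calculus)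
         (auto simp: I_def has_real_derivative_iff_has_vector_derivative[symmetric]
           intro!: has_field_derivative_at_within[OF dut])
    thus ?thesis by (simp add: integral_unique)
  qed
  have cut': "continuous_on {a..b} (\<lambda>r. ut r y)" if "{a..b} \<subseteq> T" "y \<in> X" for a b y
  proof -
    have "continuous_on {a..b} (\<lambda>r. (r, y))" by (intro continuous_intros)
    from continuous_on_compose2[OF cut this] show ?thesis using that by auto
  qed
  have cutx': "continuous_on {a..b} (\<lambda>r. utx r y)" if "{a..b} \<subseteq> T" "y \<in> X" for a b y
  proof -
    have "continuous_on {a..b} (\<lambda>r. (r, y))" by (intro continuous_intros)
    from continuous_on_compose2[OF cutx this] show ?thesis using that by auto
  qed
  have "ux s x - ux (t - e) x = integral {t - e..s} (\<lambda>r. utx r x)" if s: "s \<in> I" for s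
  proof -
    have sub: "{t - e..s} \<subseteq> T" using s IJ by (auto simp: I_def)
    have "((\<lambda>y. integral (cbox (t - e) s) (\<lambda>r. ut r y)) has_field_derivative
        integral (cbox (t - e) s) (\<lambda>r. utx r x)) (at x within J)"
    proof (rule leibniz_rule_field_derivative)
      show "((\<lambda>y. ut r y) has_real_derivative utx r y) (at y within J)"
        if "y \<in> J" "r \<in> cbox (t - e) s" for y r
        by (rule has_field_derivative_at_within[OF dutx]) (use that sub IJ in auto)
      show "(\<lambda>r. ut r y) integrable_on cbox (t - e) s" if "y \<in> J" for y
        using cut'[OF sub, of y] that IJ by (auto intro!: integrable_continuous_real)
      have "continuous_on (J \<times> cbox (t - e) s) (\<lambda>z. (snd z, fst z))"
        by (intro continuous_intros)
      moreover have "(\<lambda>z. (snd z, fst z)) ` (J \<times> cbox (t - e) s) \<subseteq> T \<times> X"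
        using sub IJ by auto
      ultimately have "continuous_on (J \<times> cbox (t - e) s) (\<lambda>z. (\<lambda>(t, x). utx t x) (snd z, fst z))"
        by (rule continuous_on_compose2[OF cutx])
      thus "continuous_on (J \<times> cbox (t - e) s) (\<lambda>(y, r). utx r y)"
        by (simp add: case_prod_beta)
    qed (use IJ in \<open>auto simp: J_def\<close>)
    from this[unfolded cbox_interval]
    have "((\<lambda>y. u s y - u (t - e) y) has_real_derivative integral {t - e..s} (\<lambda>r. utx r x))
        (at x within J)"
      by (rule DERIV_transform_on) (use IJ eq[OF s] in auto)
    hence "((\<lambda>y. u s y - u (t - e) y) has_real_derivative integral {t - e..s} (\<lambda>r. utx r x)) (at x)"
      using at_within_interior[OF IJ(4)] by simp
    moreover have "((\<lambda>y. u s y - u (t - e) y) has_real_derivative ux s x - ux (t - e) x) (at x)"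
      using e s IJ(1) x by (intro DERIV_diff dux) (auto simp: I_def)
    ultimately show ?thesis using DERIV_unique by blast
  qed
  hence eq2: "integral {t - e..s} (\<lambda>r. utx r x) = ux s x - ux (t - e) x" if "s \<in> I" for s
    using that by simp
  have "((\<lambda>s. integral {t - e..s} (\<lambda>r. utx r x)) has_real_derivative utx t x) (at t within I)"
    unfolding I_def using IJ x by (intro integral_has_real_derivative cutx') (auto simp: I_def)
  hence "((\<lambda>s. ux s x - ux (t - e) x) has_real_derivative utx t x) (at t within I)"
    by (rule DERIV_transform_on) (use IJ eq2 in auto)
  hence "((\<lambda>s. ux s x - ux (t - e) x) has_real_derivative utx t x) (at t)"
    using at_within_interior[OF IJ(3)] by simp
  moreover have "((\<lambda>s. ux s x - ux (t - e) x) has_real_derivative uxt t x - 0) (at t)"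
    by (intro DERIV_diff duxt t x DERIV_const)
  ultimately show ?thesis using DERIV_unique by fastforce
qed

text \<open>With all partial derivatives as parameters, the energy identities become polynomial
  identities in finitely many point values. \<open>hxt\<close> plays the part of both mixed
  derivatives of h. The equations are recorded at interior points; the walls are reached by
  continuity.\<close>

locale solution =
  fixes L g \<mu> m :: real and f \<xi> w :: "real \<Rightarrow> real" and h v :: "real \<Rightarrow> real \<Rightarrow> real"
    and ht hx vt vx hxx hxt vxx :: "real \<Rightarrow> real \<Rightarrow> real"
  assumes L: "0 < L" and g: "0 < g" and \<mu>: "0 < \<mu>" and m: "0 < m"
    and cont_f: "continuous_on {0..} f"
    and cont_h: "continuous_on ({0..} \<times> {0..L}) (\<lambda>(t, x). h t x)"
    and cont_hx: "continuous_on ({0..} \<times> {0..L}) (\<lambda>(t, x). hx t x)"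
    and cont_v: "continuous_on ({0..} \<times> {0..L}) (\<lambda>(t, x). v t x)"
    and cont_ht: "continuous_on ({0..} \<times> {0..L}) (\<lambda>(t, x). ht t x)"
    and cont_vt: "continuous_on ({0<..} \<times> {0..L}) (\<lambda>(t, x). vt t x)"
    and cont_vx: "continuous_on ({0<..} \<times> {0..L}) (\<lambda>(t, x). vx t x)"
    and cont_hxt: "continuous_on ({0<..} \<times> {0<..<L}) (\<lambda>(t, x). hxt t x)"
    and dht: "\<And>t x. 0 < t \<Longrightarrow> x \<in> {0<..<L} \<Longrightarrow> ((\<lambda>s. h s x) has_real_derivative ht t x) (at t)"
    and dhx: "\<And>t x. 0 < t \<Longrightarrow> x \<in> {0<..<L} \<Longrightarrow> (h t has_real_derivative hx t x) (at x)"
    and dvt: "\<And>t x. 0 < t \<Longrightarrow> x \<in> {0<..<L} \<Longrightarrow> ((\<lambda>s. v s x) has_real_derivative vt t x) (at t)"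
    and dvx: "\<And>t x. 0 < t \<Longrightarrow> x \<in> {0<..<L} \<Longrightarrow> (v t has_real_derivative vx t x) (at x)"
    and dhxt: "\<And>t x. 0 < t \<Longrightarrow> x \<in> {0<..<L} \<Longrightarrow> ((\<lambda>s. hx s x) has_real_derivative hxt t x) (at t)"
    and dhxx: "\<And>t x. 0 < t \<Longrightarrow> x \<in> {0<..<L} \<Longrightarrow> (hx t has_real_derivative hxx t x) (at x)"
    and dvxx: "\<And>t x. 0 < t \<Longrightarrow> x \<in> {0<..<L} \<Longrightarrow> (vx t has_real_derivative vxx t x) (at x)"
    and dhtx: "\<And>t x. 0 < t \<Longrightarrow> x \<in> {0<..<L} \<Longrightarrow> (ht t has_real_derivative hxt t x) (at x)"
    and h_pos: "\<And>t x. 0 \<le> t \<Longrightarrow> x \<in> {0..L} \<Longrightarrow> 0 < h t x"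
    and d\<xi>: "\<And>t. 0 \<le> t \<Longrightarrow> (\<xi> has_real_derivative w t) (at t within {0..})"
    and dw: "\<And>t. 0 \<le> t \<Longrightarrow> (w has_real_derivative - f t) (at t within {0..})"
    and continuity: "\<And>t x. 0 < t \<Longrightarrow> x \<in> {0<..<L} \<Longrightarrow> ht t x + hx t x * v t x + h t x * vx t x = 0"
    and momentum: "\<And>t x. 0 < t \<Longrightarrow> x \<in> {0<..<L} \<Longrightarrow>
      ht t x * v t x + h t x * vt t x + hx t x * (v t x)\<^sup>2 + 2 * h t x * v t x * vx t x
        + g * h t x * hx t x = \<mu> * (hx t x * vx t x + h t x * vxx t x) + h t x * f t"
    and no_slip: "\<And>t. 0 \<le> t \<Longrightarrow> v t 0 = 0" "\<And>t. 0 \<le> t \<Longrightarrow> v t L = 0"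
    and mass: "\<And>t. 0 \<le> t \<Longrightarrow> integral {0..L} (h t) = m"

lemma classical_solutionE:
  assumes "0 < L" "0 < g" "0 < \<mu>" "0 < m" and sol: "classical_solution L g \<mu> m f \<xi> w h v"
  obtains ht hx vt vx hxx hxt vxx
  where "solution L g \<mu> m f \<xi> w h v ht hx vt vx hxx hxt vxx"
proof -
  have sol_f: "C_k 0 {0..} f"
    and sol_v: "C_k 0 ({0..} \<times> {0..L}) (\<lambda>(t, x). v t x)"
      "C_k 1 ({0<..} \<times> {0..L}) (\<lambda>(t, x). v t x)" "\<forall>t>0. C_k 2 {0<..<L} (v t)"
    and sol_h: "C_k 1 ({0..} \<times> {0..L}) (\<lambda>(t, x). h t x)"
      "C_k 2 ({0<..} \<times> {0<..<L}) (\<lambda>(t, x). h t x)" "\<forall>t\<ge>0. \<forall>x\<in>{0..L}. h t x > 0"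
    and sol_ode: "\<forall>t\<ge>0. (\<xi> has_real_derivative w t) (at t within {0..})"
      "\<forall>t\<ge>0. (w has_real_derivative - f t) (at t within {0..})"
    and sol_mass: "\<forall>t>0. \<forall>x\<in>{0..L}. D_t h t x + D_x L (\<lambda>t x. h t x * v t x) t x = 0"
    and sol_mom: "\<forall>t>0. \<forall>x\<in>{0<..<L}.
        D_t (\<lambda>t x. h t x * v t x) t x +
        D_x L (\<lambda>t x. h t x * (v t x)\<^sup>2 + 1/2 * g * (h t x)\<^sup>2) t x =
        \<mu> * D_x L (\<lambda>t x. h t x * D_x L v t x) t x + h t x * f t"
    and sol_bc: "\<forall>t\<ge>0. v t 0 = 0 \<and> v t L = 0"
    and sol_m: "\<forall>t\<ge>0. (LINT x:{0..L}|lebesgue. h t x) = m"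
    using sol unfolding classical_solution_def by - (elim conjE, assumption)+
  have int: "interior ({0::real..} \<times> {0..L}) = {0<..} \<times> {0<..<L}"
    "interior ({0::real<..} \<times> {0..L}) = {0<..} \<times> {0<..<L}"
    "interior ({0::real<..} \<times> {0<..<L}) = {0<..} \<times> {0<..<L}"
    "interior {0<..<L} = {0<..<L}"
    by (simp_all add: interior_Times interior_real_atLeast interior_atLeastAtMost_real interior_open)
  have Ch: "C_k (Suc 0) ({0..} \<times> {0..L}) (\<lambda>(t, x). h t x)"
    using sol_h(1) by (simp only: One_nat_def)
  obtain ht hx where h: "C_k 0 ({0..} \<times> {0..L}) (\<lambda>(t, x). ht t x)"
    "C_k 0 ({0..} \<times> {0..L}) (\<lambda>(t, x). hx t x)"
    "\<forall>(t, x)\<in>{0<..} \<times> {0<..<L}. ((\<lambda>s. h s x) has_real_derivative ht t x) (at t)"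
    "\<forall>(t, x)\<in>{0<..} \<times> {0<..<L}. (h t has_real_derivative hx t x) (at x)"
    by (rule C_k_Suc_planeE[OF Ch, unfolded int])
  have Cv: "C_k (Suc 0) ({0<..} \<times> {0..L}) (\<lambda>(t, x). v t x)"
    using sol_v(2) by (simp only: One_nat_def)
  obtain vt vx where v: "C_k 0 ({0<..} \<times> {0..L}) (\<lambda>(t, x). vt t x)"
    "C_k 0 ({0<..} \<times> {0..L}) (\<lambda>(t, x). vx t x)"
    "\<forall>(t, x)\<in>{0<..} \<times> {0<..<L}. ((\<lambda>s. v s x) has_real_derivative vt t x) (at t)"
    "\<forall>(t, x)\<in>{0<..} \<times> {0<..<L}. (v t has_real_derivative vx t x) (at x)"
    by (rule C_k_Suc_planeE[OF Cv, unfolded int])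
  have Ch2: "C_k (Suc (Suc 0)) ({0<..} \<times> {0<..<L}) (\<lambda>(t, x). h t x)"
    using sol_h(2) by (simp only: numeral_2_eq_2)
  obtain ht' hx' where h': "C_k (Suc 0) ({0<..} \<times> {0<..<L}) (\<lambda>(t, x). ht' t x)"
    "C_k (Suc 0) ({0<..} \<times> {0<..<L}) (\<lambda>(t, x). hx' t x)"
    "\<forall>(t, x)\<in>{0<..} \<times> {0<..<L}. ((\<lambda>s. h s x) has_real_derivative ht' t x) (at t)"
    "\<forall>(t, x)\<in>{0<..} \<times> {0<..<L}. (h t has_real_derivative hx' t x) (at x)"
    by (rule C_k_Suc_planeE[OF Ch2, unfolded int])
  obtain htt htx where ht: "C_k 0 ({0<..} \<times> {0<..<L}) (\<lambda>(t, x). htt t x)"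
    "C_k 0 ({0<..} \<times> {0<..<L}) (\<lambda>(t, x). htx t x)"
    "\<forall>(t, x)\<in>{0<..} \<times> {0<..<L}. ((\<lambda>s. ht' s x) has_real_derivative htt t x) (at t)"
    "\<forall>(t, x)\<in>{0<..} \<times> {0<..<L}. (ht' t has_real_derivative htx t x) (at x)"
    by (rule C_k_Suc_planeE[OF h'(1), unfolded int])
  obtain hxt hxx where hx: "C_k 0 ({0<..} \<times> {0<..<L}) (\<lambda>(t, x). hxt t x)"
    "C_k 0 ({0<..} \<times> {0<..<L}) (\<lambda>(t, x). hxx t x)"
    "\<forall>(t, x)\<in>{0<..} \<times> {0<..<L}. ((\<lambda>s. hx' s x) has_real_derivative hxt t x) (at t)"
    "\<forall>(t, x)\<in>{0<..} \<times> {0<..<L}. (hx' t has_real_derivative hxx t x) (at x)"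
    by (rule C_k_Suc_planeE[OF h'(2), unfolded int])
  have at: "Q t x" if "\<forall>(t, x)\<in>A. Q t x" "(t, x) \<in> A" for Q A and t x :: real
    using that by auto
  note h = h(1,2) at[OF h(3)] at[OF h(4)] and v = v(1,2) at[OF v(3)] at[OF v(4)]
    and h' = h'(1,2) at[OF h'(3)] at[OF h'(4)]
    and ht = ht(1,2) at[OF ht(3)] at[OF ht(4)] and hx = hx(1,2) at[OF hx(3)] at[OF hx(4)]
  \<comment> \<open>The two regularity classes of h supply separate first derivatives, one family
    continuous up to the boundary and one differentiable inside; uniqueness identifies them in the
    interior.\<close>
  have agree: "ht' t x = ht t x" "hx' t x = hx t x" if "(t, x) \<in> {0<..} \<times> {0<..<L}" for t x
    using DERIV_unique[OF h'(3)[OF that] h(3)[OF that]] DERIV_unique[OF h'(4)[OF that] h(4)[OF that]]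
    by simp_all
  have hxt_eq: "hxt t x = htx t x" if "t \<in> {0<..}" "x \<in> {0<..<L}" for t x
    by (rule mixed_partials_eq[of "{0<..}" "{0<..<L}" ht' htx h hx' hxt])
       (use h' ht hx that in \<open>auto dest: C_k_imp_continuous_on\<close>)
  \<comment> \<open>The second derivative of v comes from a C^2 condition imposed for each time
    separately, so it is selected time by time.\<close>
  have "\<exists>vxx. \<forall>t>0. \<forall>x\<in>{0<..<L}. (vx t has_real_derivative vxx t x) (at x)"
  proof -
    have "\<exists>d. \<forall>x\<in>{0<..<L}. (vx t has_real_derivative d x) (at x)" if t: "t > 0" for t
    proof -
      have "C_k (Suc (Suc 0)) {0<..<L} (v t)"
        using sol_v(3) t by (simp only: numeral_2_eq_2)
      then obtain u where u: "C_k (Suc 0) {0<..<L} u"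
        "\<forall>z\<in>{0<..<L}. ((\<lambda>s. v t (z + s *\<^sub>R 1)) has_real_derivative u z) (at 0)"
        unfolding C_k.simps(2)[of "Suc 0"] int(4) by (metis Basis_real_def singletonI)
      have vu: "(v t has_real_derivative u z) (at z)" if "z \<in> {0<..<L}" for z
        using bspec[OF u(2) that] DERIV_shift[of "v t" "u z" 0 z] by (simp add: add.commute)
      obtain d where d: "\<And>z. z \<in> {0<..<L} \<Longrightarrow> (u has_real_derivative d z) (at z)"
        using u(1) unfolding One_nat_def[symmetric] C_k_1_real_iff int(4) by blast
      have "u z = vx t z" if "z \<in> {0<..<L}" for z
        using DERIV_unique[OF vu[OF that] v(4)[of t z]] that t by simp
      hence "(vx t has_real_derivative d z) (at z)" if "z \<in> {0<..<L}" for z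
        by (rule has_field_derivative_transform_within_open[OF d[OF that] open_greaterThanLessThan that])
           simp
      thus ?thesis by blast
    qed
    hence "\<forall>t. \<exists>d. t > 0 \<longrightarrow> (\<forall>x\<in>{0<..<L}. (vx t has_real_derivative d x) (at x))" by blast
    from choice[OF this] show ?thesis by blast
  qed
  then obtain vxx where vxx: "\<And>t x. 0 < t \<Longrightarrow> x \<in> {0<..<L} \<Longrightarrow> (vx t has_real_derivative vxx t x) (at x)"
    by blast
  have at_in: "at x within {0..L} = at x" if "x \<in> {0<..<L}" for x
    using that by (intro at_within_interior) (simp add: interior_atLeastAtMost_real)
  have Dx: "D_x L F t x = d" if "(F t has_real_derivative d) (at x)" "x \<in> {0<..<L}" for F t x d
    using that unfolding D_x_def
    by (simp add: at_in vector_derivative_at has_real_derivative_iff_has_vector_derivative)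
  have Dt: "D_t F t x = d" if "((\<lambda>s. F s x) has_real_derivative d) (at t)" for F t x d
    using that unfolding D_t_def by (rule DERIV_imp_deriv)
  have "solution L g \<mu> m f \<xi> w h v ht hx vt vx hxx hxt vxx"
  proof
    show "continuous_on {0..} f" using sol_f by simp
    show "continuous_on ({0..} \<times> {0..L}) (\<lambda>(t, x). h t x)"
      using sol_h(1) by (rule C_k_imp_continuous_on)
    show "continuous_on ({0..} \<times> {0..L}) (\<lambda>(t, x). v t x)"
      using sol_v(1) by (rule C_k_imp_continuous_on)
    show "continuous_on ({0<..} \<times> {0<..<L}) (\<lambda>(t, x). hxt t x)" using hx(1) by simp
    fix t x :: real assume t: "0 < t" and x: "x \<in> {0<..<L}"
    have tx: "(t, x) \<in> {0<..} \<times> {0<..<L}" using t x by simp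
    show dht: "((\<lambda>s. h s x) has_real_derivative ht t x) (at t)" using h(3) tx .
    show dhx: "(h t has_real_derivative hx t x) (at x)" using h(4) tx .
    show dvt: "((\<lambda>s. v s x) has_real_derivative vt t x) (at t)" using v(3) tx .
    show dvx: "(v t has_real_derivative vx t x) (at x)" using v(4) tx .
    show dvxx: "(vx t has_real_derivative vxx t x) (at x)" using vxx t x .
    show "((\<lambda>s. hx s x) has_real_derivative hxt t x) (at t)"
      by (rule has_field_derivative_transform_within_open[OF hx(3)[OF tx], of "{0<..}"])
         (use t x agree in auto)
    show "(hx t has_real_derivative hxx t x) (at x)"
      by (rule has_field_derivative_transform_within_open[OF hx(4)[OF tx], of "{0<..<L}"])
         (use t x agree in auto)
    show "(ht t has_real_derivative hxt t x) (at x)"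
      by (rule has_field_derivative_transform_within_open[of "ht' t" _ _ "{0<..<L}"])
         (use t x agree ht(4)[OF tx] hxt_eq in auto)
    have dhv: "((\<lambda>x. h t x * v t x) has_real_derivative hx t x * v t x + h t x * vx t x) (at x)"
      by (rule DERIV_cong[OF DERIV_mult[OF dhx dvx]]) simp
    have "D_t h t x + D_x L (\<lambda>t x. h t x * v t x) t x = 0" using sol_mass t x by simp
    thus "ht t x + hx t x * v t x + h t x * vx t x = 0"
      using Dt[where F = h, OF dht] Dx[where F = "\<lambda>t x. h t x * v t x", OF dhv x] by simp
    have d1: "((\<lambda>s. h s x * v s x) has_real_derivative ht t x * v t x + h t x * vt t x) (at t)"
      by (rule DERIV_cong[OF DERIV_mult[OF dht dvt]]) simp
    have d2: "((\<lambda>x. h t x * (v t x)\<^sup>2 + 1/2 * g * (h t x)\<^sup>2) has_real_derivative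
        hx t x * (v t x)\<^sup>2 + 2 * h t x * v t x * vx t x + g * h t x * hx t x) (at x)"
      by (rule DERIV_cong[OF DERIV_add[OF DERIV_mult[OF dhx DERIV_power[OF dvx, of 2]]
            DERIV_cmult[OF DERIV_power[OF dhx, of 2]]]]) simp
    have d3: "((\<lambda>x. h t x * D_x L v t x) has_real_derivative hx t x * vx t x + h t x * vxx t x) (at x)"
    proof (rule has_field_derivative_transform_within_open[of "\<lambda>x. h t x * vx t x" _ _ "{0<..<L}"])
      show "((\<lambda>x. h t x * vx t x) has_real_derivative hx t x * vx t x + h t x * vxx t x) (at x)"
        by (rule DERIV_cong[OF DERIV_mult[OF dhx dvxx]]) simp
      show "h t y * vx t y = h t y * D_x L v t y" if "y \<in> {0<..<L}" for y
        using Dx[of v t "vx t y" y] v(4)[of t y] that t by simp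
    qed (use x in auto)
    have "D_t (\<lambda>t x. h t x * v t x) t x +
        D_x L (\<lambda>t x. h t x * (v t x)\<^sup>2 + 1/2 * g * (h t x)\<^sup>2) t x =
        \<mu> * D_x L (\<lambda>t x. h t x * D_x L v t x) t x + h t x * f t"
      using sol_mom t x by blast
    thus "ht t x * v t x + h t x * vt t x + hx t x * (v t x)\<^sup>2 + 2 * h t x * v t x * vx t x
        + g * h t x * hx t x = \<mu> * (hx t x * vx t x + h t x * vxx t x) + h t x * f t"
      using Dt[where F = "\<lambda>t x. h t x * v t x", OF d1]
        Dx[where F = "\<lambda>t x. h t x * (v t x)\<^sup>2 + 1/2 * g * (h t x)\<^sup>2", OF d2 x]
        Dx[where F = "\<lambda>t x. h t x * D_x L v t x", OF d3 x] by simp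
  next
    fix t :: real assume t: "0 \<le> t"
    have c: "continuous_on {0..L} (h t)"
      using continuous_on_slice[OF C_k_imp_continuous_on[OF sol_h(1)]] t by simp
    show "integral {0..L} (h t) = m"
      using sol_m t LINT_continuous_eq_integral[OF c] by simp
  qed (use assms(1-4) h v sol_h(3) sol_ode sol_bc in auto)
  thus ?thesis by (rule that)
qed

lemma continuous_on_fixed_snd:
  assumes "continuous_on (A \<times> B) (\<lambda>(t, x). F t x)" and "x \<in> B"
  shows "continuous_on A (\<lambda>t. F t x)"
proof -
  have "continuous_on A (\<lambda>t. (t, x))" by (intro continuous_intros)
  from continuous_on_compose2[OF assms(1) this] show ?thesis using assms(2) by auto
qed

lemma continuous_on_integral_param:
  fixes F :: "real \<Rightarrow> real \<Rightarrow> real"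
  assumes "continuous_on (A \<times> {a..b}) (\<lambda>(t, x). F t x)"
  shows "continuous_on A (\<lambda>t. integral {a..b} (F t))"
  using integral_continuous_on_param[of A a b F] assms by simp

section \<open>Energy balances along a classical solution\<close>

context solution
begin

lemma pos_sub: "{0::real<..} \<times> {0..L} \<subseteq> {0..} \<times> {0..L}" "{0::real<..} \<times> {0<..<L} \<subseteq> {0<..} \<times> {0..L}"
  by (auto intro: less_imp_le)

lemma cont_f_fst: "continuous_on ({0..} \<times> {0..L}) (\<lambda>(t, x). f t)"
proof -
  have "continuous_on ({0..} \<times> {0..L}) (\<lambda>z. f (fst z))"
    by (rule continuous_on_compose2[OF cont_f]) (auto intro!: continuous_intros)
  thus ?thesis by (simp add: case_prod_beta)
qed

lemmas conts0 = cont_h[unfolded case_prod_beta] cont_hx[unfolded case_prod_beta]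
  cont_v[unfolded case_prod_beta] cont_ht[unfolded case_prod_beta] cont_f_fst[unfolded case_prod_beta]

lemmas conts1 = conts0[THEN continuous_on_subset, OF pos_sub(1)]
  cont_vt[unfolded case_prod_beta] cont_vx[unfolded case_prod_beta]

lemmas conts2 = conts1[THEN continuous_on_subset, OF pos_sub(2)] cont_hxt[unfolded case_prod_beta]

text \<open>At t = 0 no derivative is given directly, since the interior of the time axis excludes
  it. The integral identity linking h and hx holds for t > 0 and survives in the limit, because both
  are continuous down to t = 0; the initial value of V depends on this.\<close>

lemma dhx_within: "((h t) has_real_derivative hx t x) (at x within {0..L})"
  if t: "0 \<le> t" and x: "x \<in> {0..L}" for t x
proof (cases "t = 0")
  case False
  show ?thesis
    by (rule has_real_derivative_within_closed[OF _ _ dhx x])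
       (use t False in \<open>auto intro: continuous_on_slice[OF cont_h] continuous_on_slice[OF cont_hx]\<close>)
next
  case True
  have eq: "h 0 y - h 0 0 - integral {0..y} (hx 0) = 0" if y: "y \<in> {0..L}" for y
  proof (rule continuous_constant_on_closure[where S = "{0<..}" and x = 0
        and f = "\<lambda>t. h t y - h t 0 - integral {0..y} (hx t)"])
    have "continuous_on ({0..} \<times> {0..y}) (\<lambda>(t, x). hx t x)"
      by (rule continuous_on_subset[OF cont_hx]) (use y in auto)
    thus "continuous_on (closure {0<..}) (\<lambda>t. h t y - h t 0 - integral {0..y} (hx t))"
      using y L by (auto intro!: continuous_intros continuous_on_fixed_snd[OF cont_h]
          continuous_on_integral_param)
    show "h t y - h t 0 - integral {0..y} (hx t) = 0" if "t \<in> {0<..}" for t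
    proof -
      have "(hx t has_integral h t y - h t 0) {0..y}"
        using that y
        by (intro fundamental_theorem_of_calculus_interior
            continuous_on_subset[OF continuous_on_slice[OF cont_h]])
           (auto simp: has_real_derivative_iff_has_vector_derivative[symmetric] intro!: dhx)
      thus ?thesis by (simp add: integral_unique)
    qed
  qed simp
  have "((\<lambda>x. h 0 0 + integral {0..x} (hx 0)) has_real_derivative 0 + hx 0 x) (at x within {0..L})"
    using continuous_on_slice[OF cont_hx, of 0]
    by (intro DERIV_add DERIV_const integral_has_real_derivative x) auto
  hence "(h 0 has_real_derivative 0 + hx 0 x) (at x within {0..L})"
    by (rule DERIV_transform_on[OF _ x]) (use eq in force)
  thus ?thesis by (simp add: True)
qed

lemma dvx_within: "((v t) has_real_derivative vx t x) (at x within {0..L})"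
  if t: "0 < t" and x: "x \<in> {0..L}" for t x
  by (rule has_real_derivative_within_closed[OF _ _ dvx x])
     (use t in \<open>auto intro: continuous_on_slice[OF cont_v] continuous_on_slice[OF cont_vx]\<close>)

lemma profile: "profile L (h t) (hx t) g \<mu> m (v t)" if t: "0 \<le> t" for t
  by unfold_locales
     (use t L g \<mu> m h_pos mass in \<open>auto intro: dhx_within continuous_on_slice[OF cont_v]
        continuous_on_slice[OF cont_hx]\<close>)

lemma h_nz0: "z \<in> {0..} \<times> {0..L} \<Longrightarrow> h (fst z) (snd z) \<noteq> 0"
  using h_pos[of "fst z" "snd z"] by (auto simp: mem_Times_iff)

lemma h_nz2: "z \<in> {0<..} \<times> {0<..<L} \<Longrightarrow> h (fst z) (snd z) \<noteq> 0"
  using h_pos[of "fst z" "snd z"] by (auto simp: mem_Times_iff)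

abbreviation "hs \<equiv> m / L"

definition e_dens :: "real \<Rightarrow> real \<Rightarrow> real" where
  "e_dens t x = 1/2 * (h t x * (v t x)\<^sup>2) + 1/2 * g * (h t x - hs)\<^sup>2"

definition w_dens :: "real \<Rightarrow> real \<Rightarrow> real" where
  "w_dens t x = 1/2 * (inverse (h t x) * (h t x * v t x + \<mu> * hx t x)\<^sup>2)
     + 1/2 * g * (h t x - hs)\<^sup>2"

lemma cont_e_dens: "continuous_on ({0..} \<times> {0..L}) (\<lambda>(t, x). e_dens t x)"
  unfolding e_dens_def case_prod_beta by (intro continuous_intros conts0)

lemma cont_w_dens: "continuous_on ({0..} \<times> {0..L}) (\<lambda>(t, x). w_dens t x)"
  unfolding w_dens_def case_prod_beta by (intro continuous_intros conts0 ballI h_nz0)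

lemma E_fun_eq_integral: "E_fun L g hs (h t) (v t) = integral {0..L} (e_dens t)"
  if "0 \<le> t"
proof -
  interpret p: profile L "h t" "hx t" g \<mu> m "v t" using profile that .
  have "(e_dens t has_integral 1/2 * p.Kin + 1/2 * g * p.Dev) {0..L}"
    unfolding e_dens_def
    by (intro has_integral_add has_integral_mult_right integrable_integral p.int_Kin p.int_Dev)
  thus ?thesis by (simp add: p.E_fun_eq integral_unique)
qed

lemma W_fun_eq_integral: "W_fun L g \<mu> hs (h t) (v t) = integral {0..L} (w_dens t)"
  if "0 \<le> t"
proof -
  interpret p: profile L "h t" "hx t" g \<mu> m "v t" using profile that .
  have "(w_dens t has_integral 1/2 * p.Mix + 1/2 * g * p.Dev) {0..L}"
    unfolding w_dens_def
    by (intro has_integral_add has_integral_mult_right integrable_integral p.int_Mix p.int_Dev)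
  thus ?thesis by (simp add: p.W_fun_eq integral_unique)
qed

lemma continuous_on_E_fun: "continuous_on {0..} (\<lambda>t. E_fun L g hs (h t) (v t))"
  using continuous_on_integral_param[OF cont_e_dens]
  by (rule continuous_on_eq) (simp add: E_fun_eq_integral)

lemma continuous_on_W_fun: "continuous_on {0..} (\<lambda>t. W_fun L g \<mu> hs (h t) (v t))"
  using continuous_on_integral_param[OF cont_w_dens]
  by (rule continuous_on_eq) (simp add: W_fun_eq_integral)

text \<open>Multiply the momentum equation by v and use the continuity equation. Every term of the
  flux contains the factor v and therefore vanishes at the walls.\<close>

lemma E_rate_local:
  assumes t: "0 < t" and x: "x \<in> {0<..<L}"
  shows "((\<lambda>s. e_dens s x) has_real_derivative
      1/2 * ht t x * (v t x)\<^sup>2 + h t x * v t x * vt t x + g * (h t x - hs) * ht t x) (at t)"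
    and "((\<lambda>x. 1/2 * (h t x * (v t x)^3) + g * (h t x * v t x * (h t x - hs))
           - \<mu> * (h t x * (v t x * vx t x))) has_real_derivative
      (f t * (h t x * v t x) - \<mu> * (h t x * (vx t x)\<^sup>2))
       - (1/2 * ht t x * (v t x)\<^sup>2 + h t x * v t x * vt t x + g * (h t x - hs) * ht t x)) (at x)"
proof -
  note d = dht[OF t x] dhx[OF t x] dvt[OF t x] dvx[OF t x] dvxx[OF t x]
  show "((\<lambda>s. e_dens s x) has_real_derivative
      1/2 * ht t x * (v t x)\<^sup>2 + h t x * v t x * vt t x + g * (h t x - hs) * ht t x) (at t)"
    unfolding e_dens_def
    by (rule DERIV_cong, (rule d DERIV_add DERIV_diff DERIV_minus DERIV_cmult DERIV_mult DERIV_power DERIV_const)+)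
       (simp add: algebra_simps)
  have ht: "ht t x = - (hx t x * v t x + h t x * vx t x)"
    using continuity[OF t x] by linarith
  show "((\<lambda>x. 1/2 * (h t x * (v t x)^3) + g * (h t x * v t x * (h t x - hs))
           - \<mu> * (h t x * (v t x * vx t x))) has_real_derivative
      (f t * (h t x * v t x) - \<mu> * (h t x * (vx t x)\<^sup>2))
       - (1/2 * ht t x * (v t x)\<^sup>2 + h t x * v t x * vt t x + g * (h t x - hs) * ht t x)) (at x)"
    by (rule DERIV_cong, (rule d DERIV_add DERIV_diff DERIV_minus DERIV_cmult DERIV_mult DERIV_power DERIV_const)+)
      (simp add: eval_nat_numeral, use momentum[OF t x] ht in algebra)
qed

text \<open>With p = h v + mu h_x, the quantity p^2 / (2 h) is transported by v. The flux again
  contains v in every term, so no boundary condition on h_x is required.\<close>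

lemma W_rate_local:
  assumes t: "0 < t" and x: "x \<in> {0<..<L}"
  defines "p \<equiv> h t x * v t x + \<mu> * hx t x"
    and "pt \<equiv> ht t x * v t x + h t x * vt t x + \<mu> * hxt t x"
  defines "Ft \<equiv> inverse (h t x) * p * pt - 1/2 * (inverse (h t x))\<^sup>2 * ht t x * p\<^sup>2
      + g * (h t x - hs) * ht t x"
  shows "((\<lambda>s. w_dens s x) has_real_derivative Ft) (at t)"
    and "((\<lambda>x. 1/2 * (v t x * (inverse (h t x) * (h t x * v t x + \<mu> * hx t x)\<^sup>2))
            + g * (h t x * v t x * (h t x - hs))) has_real_derivative
      (f t * (h t x * v t x + \<mu> * hx t x) - \<mu> * g * (hx t x)\<^sup>2) - Ft) (at x)"
proof -
  note d = dht[OF t x] dhx[OF t x] dvt[OF t x] dvx[OF t x] dvxx[OF t x] dhxt[OF t x] dhxx[OF t x]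
  have nz: "h t x \<noteq> 0" using h_pos[of t x] t x by auto
  \<comment> \<open>Treating the reciprocal as a variable with h i = 1 makes the identities
    polynomial, hence accessible to \<open>algebra\<close>.\<close>
  define i where "i = inverse (h t x)"
  have i: "h t x * i = 1" using nz by (simp add: i_def)
  have dit: "((\<lambda>s. inverse (h s x)) has_real_derivative - (i\<^sup>2 * ht t x)) (at t)"
    by (rule DERIV_cong[OF DERIV_inverse_fun[OF d(1) nz]]) (simp add: i_def power2_eq_square)
  have dix: "((\<lambda>x. inverse (h t x)) has_real_derivative - (i\<^sup>2 * hx t x)) (at x)"
    by (rule DERIV_cong[OF DERIV_inverse_fun[OF d(2) nz]]) (simp add: i_def power2_eq_square)
  have dpt: "((\<lambda>s. h s x * v s x + \<mu> * hx s x) has_real_derivative pt) (at t)"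
    unfolding pt_def
    by (rule DERIV_cong, (rule d DERIV_add DERIV_diff DERIV_minus DERIV_cmult DERIV_mult DERIV_power DERIV_const)+) simp
  define px where "px = hx t x * v t x + h t x * vx t x + \<mu> * hxx t x"
  have dpx: "((\<lambda>x. h t x * v t x + \<mu> * hx t x) has_real_derivative px) (at x)"
    unfolding px_def
    by (rule DERIV_cong, (rule d DERIV_add DERIV_diff DERIV_minus DERIV_cmult DERIV_mult DERIV_power DERIV_const)+) simp
  have ht: "ht t x = - (hx t x * v t x + h t x * vx t x)"
    using continuity[OF t x] by linarith
  \<comment> \<open>The x-derivative of the continuity equation; it brings in the second derivative
    of v that cancels the viscous term.\<close>
  have hxt: "hxt t x = - (hxx t x * v t x + 2 * hx t x * vx t x + h t x * vxx t x)"
  proof -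
    have "((\<lambda>y. - (hx t y * v t y + h t y * vx t y)) has_real_derivative
        - (hxx t x * v t x + 2 * hx t x * vx t x + h t x * vxx t x)) (at x)"
      by (rule DERIV_cong, (rule d DERIV_add DERIV_diff DERIV_minus DERIV_cmult DERIV_mult DERIV_power DERIV_const)+) simp
    hence "(ht t has_real_derivative
        - (hxx t x * v t x + 2 * hx t x * vx t x + h t x * vxx t x)) (at x)"
    proof (rule has_field_derivative_transform_within_open[of _ _ _ "{0<..<L}"])
      show "- (hx t y * v t y + h t y * vx t y) = ht t y" if "y \<in> {0<..<L}" for y
        using continuity[OF t that] by linarith
    qed (use x in auto)
    thus ?thesis using dhtx[OF t x] DERIV_unique by blast
  qed
  show "((\<lambda>s. w_dens s x) has_real_derivative Ft) (at t)"
    unfolding w_dens_def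
    by (rule DERIV_cong, (rule dit dpt d DERIV_add DERIV_diff DERIV_minus DERIV_cmult DERIV_mult DERIV_power DERIV_const)+)
       (simp add: Ft_def p_def i_def[symmetric] algebra_simps)
  \<comment> \<open>This is p_t + (v p)_x = h (f - g h_x): no second derivatives remain on the
    right.\<close>
  have transport: "pt + vx t x * p + v t x * px = h t x * (f t - g * hx t x)"
    unfolding pt_def p_def px_def hxt using momentum[OF t x] ht by algebra
  have flux: "1/2 * (vx t x * (i * p\<^sup>2) + (- (i\<^sup>2 * hx t x) * p\<^sup>2 + 2 * p * px * i) * v t x)
      = f t * p - p * g * hx t x - (i * p * pt - 1/2 * i\<^sup>2 * ht t x * p\<^sup>2)"
    using transport i ht by algebra
  have dP: "((\<lambda>x. 1/2 * (v t x * (inverse (h t x) * (h t x * v t x + \<mu> * hx t x)\<^sup>2))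
            + g * (h t x * v t x * (h t x - hs))) has_real_derivative
      1/2 * (vx t x * (i * p\<^sup>2) + (- (i\<^sup>2 * hx t x) * p\<^sup>2 + 2 * p * px * i) * v t x)
      + g * ((hx t x * v t x + h t x * vx t x) * (h t x - hs) + hx t x * (h t x * v t x))) (at x)"
    by (rule DERIV_cong, (rule dix dpx d DERIV_add DERIV_diff DERIV_minus DERIV_cmult DERIV_mult DERIV_power DERIV_const)+)
       (simp add: p_def i_def[symmetric] algebra_simps)
  show "((\<lambda>x. 1/2 * (v t x * (inverse (h t x) * (h t x * v t x + \<mu> * hx t x)\<^sup>2))
            + g * (h t x * v t x * (h t x - hs))) has_real_derivative
      (f t * (h t x * v t x + \<mu> * hx t x) - \<mu> * g * (hx t x)\<^sup>2) - Ft) (at x)"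
    unfolding Ft_def i_def[symmetric]
    by (rule DERIV_cong[OF dP], unfold flux) (unfold p_def ht, algebra)
qed

lemma E_rate:
  assumes t: "0 < t"
  shows "((\<lambda>t. E_fun L g hs (h t) (v t)) has_real_derivative
    f t * integral {0..L} (\<lambda>x. h t x * v t x)
      - \<mu> * integral {0..L} (\<lambda>x. h t x * (vx t x)\<^sup>2)) (at t)"
proof -
  interpret p: profile L "h t" "hx t" g \<mu> m "v t" using profile t by simp
  have cvx: "continuous_on {0..L} (vx t)" using continuous_on_slice[OF cont_vx] t by simp
  have "((\<lambda>t. integral {0..L} (e_dens t)) has_real_derivative
      integral {0..L} (\<lambda>x. f t * (h t x * v t x) - \<mu> * (h t x * (vx t x)\<^sup>2))) (at t)"
  proof (rule balance_law_has_derivative[OF L _ _ _ _ E_rate_local _ _ t])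
    show "continuous_on ({0<..} \<times> {0..L}) (\<lambda>(t, x). e_dens t x)"
      using cont_e_dens pos_sub(1) by (rule continuous_on_subset)
    show "continuous_on ({0<..} \<times> {0..L}) (\<lambda>(t, x). 1/2 * (h t x * (v t x)^3)
        + g * (h t x * v t x * (h t x - hs)) - \<mu> * (h t x * (v t x * vx t x)))"
      unfolding case_prod_beta by (intro continuous_intros conts1)
    show "continuous_on ({0<..} \<times> {0..L})
        (\<lambda>(t, x). f t * (h t x * v t x) - \<mu> * (h t x * (vx t x)\<^sup>2))"
      unfolding case_prod_beta by (intro continuous_intros conts1)
    show "continuous_on ({0<..} \<times> {0<..<L}) (\<lambda>(t, x). 1/2 * ht t x * (v t x)\<^sup>2
        + h t x * v t x * vt t x + g * (h t x - hs) * ht t x)"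
      unfolding case_prod_beta by (intro continuous_intros conts2)
  qed (use no_slip in auto)
  moreover have "((\<lambda>x. f t * (h t x * v t x) - \<mu> * (h t x * (vx t x)\<^sup>2)) has_integral
      f t * integral {0..L} (\<lambda>x. h t x * v t x)
      - \<mu> * integral {0..L} (\<lambda>x. h t x * (vx t x)\<^sup>2)) {0..L}"
    by (intro has_integral_diff has_integral_mult_right integrable_integral
        integrable_continuous_real p.conts cvx)
  ultimately have "((\<lambda>t. integral {0..L} (e_dens t)) has_real_derivative
      f t * integral {0..L} (\<lambda>x. h t x * v t x)
      - \<mu> * integral {0..L} (\<lambda>x. h t x * (vx t x)\<^sup>2)) (at t)"
    by (simp add: integral_unique)
  thus ?thesis
    by (rule has_field_derivative_transform_within_open[of _ _ _ "{0<..}"])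
       (use t in \<open>auto simp: E_fun_eq_integral\<close>)
qed

lemma W_rate:
  assumes t: "0 < t"
  shows "((\<lambda>t. W_fun L g \<mu> hs (h t) (v t)) has_real_derivative
    f t * (integral {0..L} (\<lambda>x. h t x * v t x) + \<mu> * (h t L - h t 0))
      - \<mu> * g * integral {0..L} (\<lambda>x. (hx t x)\<^sup>2)) (at t)"
proof -
  interpret p: profile L "h t" "hx t" g \<mu> m "v t" using profile t by simp
  have "((\<lambda>t. integral {0..L} (w_dens t)) has_real_derivative
      integral {0..L} (\<lambda>x. f t * (h t x * v t x + \<mu> * hx t x) - \<mu> * g * (hx t x)\<^sup>2)) (at t)"
  proof (rule balance_law_has_derivative[OF L _ _ _ _ W_rate_local _ _ t])
    show "continuous_on ({0<..} \<times> {0..L}) (\<lambda>(t, x). w_dens t x)"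
      using cont_w_dens pos_sub(1) by (rule continuous_on_subset)
    have nz: "\<forall>z\<in>{0<..} \<times> {0..L}. h (fst z) (snd z) \<noteq> 0" using h_nz0 by auto
    show "continuous_on ({0<..} \<times> {0..L}) (\<lambda>(t, x).
        1/2 * (v t x * (inverse (h t x) * (h t x * v t x + \<mu> * hx t x)\<^sup>2))
            + g * (h t x * v t x * (h t x - hs)))"
      unfolding case_prod_beta by (intro continuous_intros conts1 nz)
    show "continuous_on ({0<..} \<times> {0..L})
        (\<lambda>(t, x). f t * (h t x * v t x + \<mu> * hx t x) - \<mu> * g * (hx t x)\<^sup>2)"
      unfolding case_prod_beta by (intro continuous_intros conts1)
    show "continuous_on ({0<..} \<times> {0<..<L}) (\<lambda>(t, x).
        inverse (h t x) * (h t x * v t x + \<mu> * hx t x)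
          * (ht t x * v t x + h t x * vt t x + \<mu> * hxt t x)
        - 1/2 * (inverse (h t x))\<^sup>2 * ht t x * (h t x * v t x + \<mu> * hx t x)\<^sup>2
        + g * (h t x - hs) * ht t x)"
      unfolding case_prod_beta by (intro continuous_intros conts2 ballI h_nz2)
  qed (use no_slip in auto)
  moreover have "((\<lambda>x. f t * (h t x * v t x + \<mu> * hx t x) - \<mu> * g * (hx t x)\<^sup>2) has_integral
      f t * (integral {0..L} (\<lambda>x. h t x * v t x) + \<mu> * (h t L - h t 0))
      - \<mu> * g * integral {0..L} (\<lambda>x. (hx t x)\<^sup>2)) {0..L}"
  proof (intro has_integral_diff has_integral_mult_right has_integral_add)
    show "(hx t has_integral h t L - h t 0) {0..L}"
      using L p.deriv
      by (intro fundamental_theorem_of_calculus)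
         (auto simp: has_real_derivative_iff_has_vector_derivative[symmetric])
  qed (intro integrable_integral integrable_continuous_real p.conts)+
  ultimately have "((\<lambda>t. integral {0..L} (w_dens t)) has_real_derivative
      f t * (integral {0..L} (\<lambda>x. h t x * v t x) + \<mu> * (h t L - h t 0))
      - \<mu> * g * integral {0..L} (\<lambda>x. (hx t x)\<^sup>2)) (at t)"
    by (simp add: integral_unique)
  thus ?thesis
    by (rule has_field_derivative_transform_within_open[of _ _ _ "{0<..}"])
       (use t in \<open>auto simp: W_fun_eq_integral\<close>)
qed

end

subsection \<open>The closed loop\<close>

text \<open>The difference of the two sides is a single square; equality holds when \<alpha> x =
  \<beta> y, so the sum of inverse weights is the best factor.\<close>

lemma weighted_square_add_le:
  fixes x y :: real
  assumes "0 < \<alpha>" "0 < \<beta>"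
  shows "(x + y)\<^sup>2 \<le> (1 / \<alpha> + 1 / \<beta>) * (\<alpha> * x\<^sup>2 + \<beta> * y\<^sup>2)"
proof -
  have "(1 / \<alpha> + 1 / \<beta>) * (\<alpha> * x\<^sup>2 + \<beta> * y\<^sup>2) - (x + y)\<^sup>2 = (\<alpha> * x - \<beta> * y)\<^sup>2 / (\<alpha> * \<beta>)"
    using assms by (simp add: field_simps power2_eq_square)
  moreover have "0 \<le> (\<alpha> * x - \<beta> * y)\<^sup>2 / (\<alpha> * \<beta>)" using assms by simp
  ultimately show ?thesis by linarith
qed

text \<open>Two terms merge into one whose effective weight has inverse 1/\<alpha> + 1/\<beta>; the
  two-term inequality is then applied again.\<close>

lemma weighted_square_add3_le:
  fixes x y z :: real
  assumes "0 < \<alpha>" "0 < \<beta>" "0 < \<gamma>"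
  shows "(x + y + z)\<^sup>2 \<le> (1 / \<alpha> + 1 / \<beta> + 1 / \<gamma>) * (\<alpha> * x\<^sup>2 + \<beta> * y\<^sup>2 + \<gamma> * z\<^sup>2)"
proof -
  define K where "K = 1 / \<alpha> + 1 / \<beta>"
  have K: "0 < K" using assms by (simp add: K_def add_pos_pos)
  have "(1 / K) * (x + y)\<^sup>2 \<le> \<alpha> * x\<^sup>2 + \<beta> * y\<^sup>2"
    using weighted_square_add_le[OF assms(1,2), of x y] K
    by (simp add: K_def[symmetric] divide_le_eq mult.commute)
  hence "(K + 1 / \<gamma>) * (1 / K * (x + y)\<^sup>2 + \<gamma> * z\<^sup>2)
      \<le> (K + 1 / \<gamma>) * (\<alpha> * x\<^sup>2 + \<beta> * y\<^sup>2 + \<gamma> * z\<^sup>2)"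
    using K assms by (intro mult_left_mono) auto
  moreover have "(x + y + z)\<^sup>2 \<le> (K + 1 / \<gamma>) * (1 / K * (x + y)\<^sup>2 + \<gamma> * z\<^sup>2)"
    using weighted_square_add_le[of "1 / K" \<gamma> "x + y" z] K assms by simp
  ultimately show ?thesis by (simp add: K_def)
qed

text \<open>\<open>h1\<close> and \<open>H\<close> are the height bounds guaranteed on \<open>{V \<le> r'}\<close>.\<close>

locale gains =
  fixes L g \<mu> m H h1 \<sigma> q k r' :: real
  assumes pos: "0 < L" "0 < g" "0 < \<mu>" "0 < m" "0 < H" "0 < h1" "0 < \<sigma>" "0 < q" "0 < k"
    and lower: "c_const g \<mu> * r' \<le> - G_fun (m / L) h1"
    and upper: "c_const g \<mu> * r' \<le> G_fun (m / L) H"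
    and gain: "k * (b_const L g \<mu> m H \<sigma> + h1) < q * theta L g \<mu> \<sigma> * h1"
begin

abbreviation "\<theta> \<equiv> theta L g \<mu> \<sigma>"

definition "K = (1 + b_const L g \<mu> m H \<sigma> / h1) / \<theta>"
text \<open>The share of the dissipation left after q k y^2, which is at most (k K / q) D, has been
  absorbed.\<close>

definition "\<delta> = 1 - k * K / q"
text \<open>Dissipation controls V except for its \<xi> term. The three summands belong to the
  kinetic part, the slope part and y^2.\<close>

definition "C_diss = 3/2 * (H * L\<^sup>2 / (pi\<^sup>2 * h1)) / \<mu> + (\<mu>\<^sup>2 / h1 + g * L\<^sup>2) / (\<mu> * g) + K / (2 * q)"
text \<open>The first entry is the decay afforded by the remaining dissipation, the second the decay
  of the \<xi> term, which D does not see.\<close>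

definition "rate = min (\<delta> / C_diss) (2 * k)"
text \<open>\<open>C_up\<close> and \<open>C_low\<close> add up the coefficients needed for the
  single parts of the norm. In \<open>C_low\<close>, the summand 8 / q results from w = y - k
  \<xi>.\<close>

definition "C_up = 3/2 * H + \<mu>\<^sup>2 / h1 + g + 3/2 * (q * k\<^sup>2) + q"
definition "C_low = 2 / h1 + 4 * H / \<mu>\<^sup>2 + 1 / g + 2 / (q * k\<^sup>2) + 8 / q"

lemma \<theta>_pos: "0 < \<theta>"
  using pos by (simp add: theta_def add_pos_pos)

lemma b_pos: "0 < b_const L g \<mu> m H \<sigma>"
  using pos \<theta>_pos by (simp add: b_const_def)

lemma K_pos: "0 < K"
  using pos \<theta>_pos b_pos by (simp add: K_def add_pos_pos)

text \<open>Divided by \<theta> h1, the condition \<open>gain\<close> says k K < q.\<close>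

lemma \<delta>_pos: "0 < \<delta>"
proof -
  have "k * K = k * (b_const L g \<mu> m H \<sigma> + h1) / (\<theta> * h1)"
    using pos \<theta>_pos by (simp add: K_def field_simps)
  also have "\<dots> < q"
    using gain pos \<theta>_pos by (simp add: divide_less_eq mult.assoc)
  finally show ?thesis using pos by (simp add: \<delta>_def)
qed

lemma C_diss_pos: "0 < C_diss"
  unfolding C_diss_def using pos K_pos
  by (intro add_pos_pos divide_pos_pos mult_pos_pos zero_less_power) auto

lemma rate_pos: "0 < rate"
  using \<delta>_pos C_diss_pos pos by (simp add: rate_def)

lemma C_up_pos: "0 < C_up"
  unfolding C_up_def using pos by (intro add_pos_pos divide_pos_pos mult_pos_pos zero_less_power) auto

lemma C_low_pos: "0 < C_low"
  unfolding C_low_def using pos by (intro add_pos_pos divide_pos_pos mult_pos_pos zero_less_power) auto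

text \<open>These weights bound the three squares by the slope, viscous and feedback parts of D in
  turn; the identity is the origin of the formulas for \<open>theta\<close> and
  \<open>b_const\<close>.\<close>

lemma inverse_weights:
  "1 / (g / (\<mu> * L)) + 1 / (\<mu> * pi\<^sup>2 * h1 / (4 * m * H * L\<^sup>2)) + 1 / \<sigma> = K"
proof -
  have "1 / \<theta> = 1 / \<sigma> + \<mu> * L / g" using pos by (simp add: theta_def field_simps)
  moreover have "b_const L g \<mu> m H \<sigma> / \<theta> = 4 * m * L\<^sup>2 * H / (\<mu> * pi\<^sup>2)"
    using \<theta>_pos by (simp add: b_const_def)
  moreover have "K = 1 / \<theta> + b_const L g \<mu> m H \<sigma> / \<theta> / h1"
    by (simp add: K_def add_divide_distrib mult.commute)
  ultimately show ?thesis by (simp add: mult_ac)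
qed

end

locale closed_loop = gains + solution +
  assumes feedback: "\<And>t. 0 < t \<Longrightarrow> f t = feedback_law L \<mu> \<sigma> q k (\<xi> t, w t, h t, v t)"
begin

abbreviation "V t \<equiv> V_fun L g \<mu> m q k (\<xi> t, w t, h t, v t)"
abbreviation "y t \<equiv> w t + k * \<xi> t"
abbreviation "Mom t \<equiv> integral {0..L} (\<lambda>x. h t x * v t x)"
abbreviation "A t \<equiv> 2 * Mom t + \<mu> * (h t L - h t 0)"
abbreviation "Slope t \<equiv> integral {0..L} (\<lambda>x. (hx t x)\<^sup>2)"
abbreviation "Visc t \<equiv> integral {0..L} (\<lambda>x. h t x * (vx t x)\<^sup>2)"
abbreviation "D t \<equiv> \<mu> * g * Slope t + \<mu> * Visc t + \<sigma> * (A t - q * y t)\<^sup>2"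
abbreviation "N t \<equiv> X_norm L (\<xi> t, w t, (\<lambda>x. h t x - hs), v t)"

lemma V_eq: "V t = W_fun L g \<mu> hs (h t) (v t) + E_fun L g hs (h t) (v t)
    + q * k\<^sup>2 / 2 * (\<xi> t)\<^sup>2 + q / 2 * (y t)\<^sup>2"
  by (simp add: V_fun_def)

lemma f_eq: "0 < t \<Longrightarrow> f t = - \<sigma> * (A t - q * y t)"
proof -
  assume t: "0 < t"
  interpret p: profile L "h t" "hx t" g \<mu> m "v t" using profile t by simp
  have "(LINT x:{0..L}|lebesgue. h t x * v t x) = Mom t"
    by (intro LINT_continuous_eq_integral p.conts)
  thus ?thesis using feedback[OF t] by (simp add: feedback_law_def)
qed

lemma continuous_on_V: "continuous_on {0..} V"
proof -
  have "continuous_on {0..} \<xi>" by (rule DERIV_continuous_on) (use d\<xi> in auto)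
  moreover have "continuous_on {0..} w" by (rule DERIV_continuous_on) (use dw in auto)
  ultimately show ?thesis
    unfolding V_eq by (intro continuous_intros continuous_on_E_fun continuous_on_W_fun)
qed

text \<open>The power of f in the fluid is f A and in the tank -q f y; together they give f (A - q
  y), which the feedback makes a negative square. Substituting w = y - k \<xi>, the weight q k^2 / 2
  on \<xi>^2 is the one for which the mixed \<xi> y terms cancel.\<close>

lemma V_rate:
  assumes t: "0 < t"
  shows "(V has_real_derivative - D t + q * k * (y t)\<^sup>2 - q * k^3 * (\<xi> t)\<^sup>2) (at t)"
proof -
  have at: "at t within {0..} = at t"
    by (rule at_within_interior) (use t in \<open>simp add: interior_real_atLeast\<close>)
  have d\<xi>': "(\<xi> has_real_derivative w t) (at t)" using d\<xi>[of t] t at by simp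
  have dw': "(w has_real_derivative - f t) (at t)" using dw[of t] t at by simp
  have "(V has_real_derivative
      (f t * (Mom t + \<mu> * (h t L - h t 0)) - \<mu> * g * Slope t) + (f t * Mom t - \<mu> * Visc t)
      + q * k\<^sup>2 / 2 * (2 * (w t * \<xi> t)) + q / 2 * (2 * ((- f t + k * w t) * y t))) (at t)"
    unfolding V_eq
    by (rule DERIV_cong, (rule W_rate[OF t] E_rate[OF t] d\<xi>' dw' DERIV_add DERIV_cmult DERIV_power)+)
       (simp add: algebra_simps)
  also have "(f t * (Mom t + \<mu> * (h t L - h t 0)) - \<mu> * g * Slope t) + (f t * Mom t - \<mu> * Visc t)
      + q * k\<^sup>2 / 2 * (2 * (w t * \<xi> t)) + q / 2 * (2 * ((- f t + k * w t) * y t))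
    = - D t + q * k * (y t)\<^sup>2 - q * k^3 * (\<xi> t)\<^sup>2"
    unfolding f_eq[OF t] by (simp add: power2_eq_square power3_eq_cube algebra_simps)
  finally show ?thesis .
qed

lemma WE_nonneg:
  assumes t: "0 \<le> t"
  shows "0 \<le> W_fun L g \<mu> hs (h t) (v t) + E_fun L g hs (h t) (v t)"
proof -
  interpret p: profile L "h t" "hx t" g \<mu> m "v t" using profile t .
  have "0 \<le> p.Mix" using p.h_pos by (intro integral_nonneg p.int_Mix) (simp add: less_imp_le)
  moreover have "0 \<le> p.Kin" using p.h_pos by (intro integral_nonneg p.int_Kin) (simp add: less_imp_le)
  moreover have "0 \<le> g * p.Dev"
    using g by (intro mult_nonneg_nonneg integral_nonneg p.int_Dev) auto
  ultimately show ?thesis by (simp add: p.E_fun_eq p.W_fun_eq)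
qed

lemma WE_le_V: "W_fun L g \<mu> hs (h t) (v t) + E_fun L g hs (h t) (v t) \<le> V t"
  using pos by (simp add: V_eq)

lemma V_nonneg: "0 \<le> t \<Longrightarrow> 0 \<le> V t"
  using WE_nonneg WE_le_V order_trans by blast

lemma bounded_profile:
  assumes t: "0 \<le> t" and V: "V t \<le> r'"
  shows "bounded_profile L (h t) (hx t) g \<mu> m (v t) h1 H"
proof -
  interpret p: profile L "h t" "hx t" g \<mu> m "v t" using profile t .
  have c: "0 < c_const g \<mu>" using g \<mu> by (simp add: c_const_def)
  have G: "\<bar>G_fun hs (h t x)\<bar> \<le> c_const g \<mu> * r'" if "x \<in> {0..L}" for x
  proof -
    have "c_const g \<mu> * (W_fun L g \<mu> hs (h t) (v t) + E_fun L g hs (h t) (v t)) \<le> c_const g \<mu> * r'"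
      using WE_le_V[of t] V c by (intro mult_left_mono) auto
    thus ?thesis using p.G_fun_le[OF that] by linarith
  qed
  show ?thesis
  proof
    show "0 < h1" using pos by simp
    fix x assume x: "x \<in> {0..L}"
    show "h1 \<le> h t x"
    proof (rule ccontr)
      assume "\<not> h1 \<le> h t x"
      hence "G_fun hs (h t x) < G_fun hs h1"
        using G_fun_strict_mono[OF p.hs_pos p.h_pos[OF x]] by simp
      thus False using G[OF x] lower by linarith
    qed
    show "h t x \<le> H"
    proof (rule ccontr)
      assume "\<not> h t x \<le> H"
      hence "G_fun hs H < G_fun hs (h t x)"
        using G_fun_strict_mono[OF p.hs_pos pos(5)] by simp
      thus False using G[OF x] upper by linarith
    qed
  qed
qed

lemma V_rate_le:
  assumes t: "0 < t" and V: "V t \<le> r'"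
  shows "- D t + q * k * (y t)\<^sup>2 - q * k^3 * (\<xi> t)\<^sup>2 \<le> - rate * V t"
proof -
  interpret p: bounded_profile L "h t" "hx t" g \<mu> m "v t" h1 H
    using bounded_profile[OF _ V] t by simp
  have cvx: "continuous_on {0..L} (vx t)" using continuous_on_slice[OF cont_vx] t by simp
  define a where "a = H * L\<^sup>2 / (pi\<^sup>2 * h1)"
  have a: "0 < a" using pos by (simp add: a_def)
  have Kin: "p.Kin \<le> a * Visc t"
    unfolding a_def by (rule p.Kin_le_dissipation[OF dvx_within[OF t] cvx]) (use no_slip t in auto)
  have Visc: "0 \<le> Visc t"
    using p.h_pos by (intro integral_nonneg integrable_continuous_real p.conts cvx)
      (simp add: less_imp_le)
  have Slope: "0 \<le> Slope t" by (intro integral_nonneg p.int_Slope) simp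
  have y_le: "(q * y t)\<^sup>2 \<le> K * D t"
  proof -
    \<comment> \<open>The first weight is dictated by \<open>p.end_difference_le\<close>, the second
      by \<open>p.momentum_le\<close> combined with \<open>Kin\<close>; its 4 compensates the factor
      2 in front of the momentum.\<close>
    let ?\<alpha> = "g / (\<mu> * L)" and ?\<beta> = "\<mu> * pi\<^sup>2 * h1 / (4 * m * H * L\<^sup>2)"
    have \<beta>: "?\<beta> = \<mu> / (4 * m * a)" using pos by (simp add: a_def field_simps)
    have "(q * y t)\<^sup>2 = (\<mu> * (h t L - h t 0) + 2 * Mom t + - (A t - q * y t))\<^sup>2"
      by (simp add: algebra_simps)
    also have "\<dots> \<le> (1 / ?\<alpha> + 1 / ?\<beta> + 1 / \<sigma>) * (?\<alpha> * (\<mu> * (h t L - h t 0))\<^sup>2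
        + ?\<beta> * (2 * Mom t)\<^sup>2 + \<sigma> * (- (A t - q * y t))\<^sup>2)"
      using pos by (intro weighted_square_add3_le divide_pos_pos mult_pos_pos zero_less_power) auto
    also have "\<dots> \<le> K * D t"
    proof -
      have "?\<alpha> * (\<mu> * (h t L - h t 0))\<^sup>2 = g * \<mu> / L * (h t L - h t 0)\<^sup>2"
        using pos by (simp add: power_mult_distrib power2_eq_square)
      also have "\<dots> \<le> g * \<mu> / L * (L * Slope t)"
        using pos p.end_difference_le by (intro mult_left_mono) auto
      finally have 1: "?\<alpha> * (\<mu> * (h t L - h t 0))\<^sup>2 \<le> \<mu> * g * Slope t"
        using pos by (simp add: mult.commute)
      have "(Mom t)\<^sup>2 \<le> m * (a * Visc t)"
        using p.momentum_le mult_left_mono[OF Kin, of m] pos by linarith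
      hence "?\<beta> * (2 * Mom t)\<^sup>2 \<le> \<mu> / (4 * m * a) * (4 * (m * (a * Visc t)))"
        unfolding \<beta> using pos a by (intro mult_left_mono) (auto simp: power_mult_distrib)
      also have "\<dots> = \<mu> * Visc t" using pos a by simp
      finally have 2: "?\<beta> * (2 * Mom t)\<^sup>2 \<le> \<mu> * Visc t" .
      have 3: "\<sigma> * (- (A t - q * y t))\<^sup>2 = \<sigma> * (A t - q * y t)\<^sup>2"
        by (simp only: power2_minus)
      show ?thesis unfolding inverse_weights 3
        using 1 2 K_pos by (intro mult_left_mono) auto
    qed
    finally show ?thesis .
  qed
  have D: "0 \<le> D t" using pos Visc Slope by simp
  have D_parts: "\<mu> * Visc t \<le> D t" "\<mu> * g * Slope t \<le> D t" using pos Visc Slope by auto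
  have qk: "q * k * (y t)\<^sup>2 \<le> (1 - \<delta>) * D t"
  proof -
    have "q * k * (y t)\<^sup>2 = k / q * (q * y t)\<^sup>2" using pos by (simp add: power2_eq_square)
    also have "\<dots> \<le> k / q * (K * D t)" using y_le pos by (intro mult_left_mono) auto
    finally show ?thesis by (simp add: \<delta>_def)
  qed
  \<comment> \<open>The \<xi> term is kept apart: it is damped by -q k^3 \<xi>^2 and not by
    D.\<close>
  have "V t \<le> C_diss * D t + q * k\<^sup>2 / 2 * (\<xi> t)\<^sup>2"
  proof -
    have "W_fun L g \<mu> hs (h t) (v t) + E_fun L g hs (h t) (v t) = 1/2 * p.Kin + 1/2 * p.Mix + g * p.Dev"
      by (simp add: p.W_fun_eq p.E_fun_eq algebra_simps)
    also have "\<dots> \<le> 3/2 * p.Kin + (\<mu>\<^sup>2 / h1 + g * L\<^sup>2) * Slope t"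
    proof -
      have "p.Mix \<le> 2 * p.Kin + 2 * (\<mu>\<^sup>2 / h1 * Slope t)" using p.Mix_le by simp
      moreover have "g * p.Dev \<le> g * (L\<^sup>2 * Slope t)" using p.Dev_le g by (intro mult_left_mono) auto
      moreover have "(\<mu>\<^sup>2 / h1 + g * L\<^sup>2) * Slope t = \<mu>\<^sup>2 / h1 * Slope t + g * (L\<^sup>2 * Slope t)"
        by (simp only: distrib_right mult.assoc)
      ultimately show ?thesis by linarith
    qed
    also have "3/2 * p.Kin \<le> 3/2 * a / \<mu> * (\<mu> * Visc t)" using Kin pos by simp
    also have "\<dots> \<le> 3/2 * a / \<mu> * D t" using D_parts a pos by (intro mult_left_mono) auto
    also have "(\<mu>\<^sup>2 / h1 + g * L\<^sup>2) * Slope t = (\<mu>\<^sup>2 / h1 + g * L\<^sup>2) / (\<mu> * g) * (\<mu> * g * Slope t)"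
      using pos by simp
    also have "\<dots> \<le> (\<mu>\<^sup>2 / h1 + g * L\<^sup>2) / (\<mu> * g) * D t"
      using D_parts pos by (intro mult_left_mono divide_nonneg_nonneg add_nonneg_nonneg) auto
    finally have 1: "W_fun L g \<mu> hs (h t) (v t) + E_fun L g hs (h t) (v t)
        \<le> 3/2 * a / \<mu> * D t + (\<mu>\<^sup>2 / h1 + g * L\<^sup>2) / (\<mu> * g) * D t" by simp
    have "q / 2 * (y t)\<^sup>2 = 1 / (2 * q) * (q * y t)\<^sup>2" using pos by (simp add: power2_eq_square)
    also have "\<dots> \<le> 1 / (2 * q) * (K * D t)" using y_le pos by (intro mult_left_mono) auto
    finally have 2: "q / 2 * (y t)\<^sup>2 \<le> K / (2 * q) * D t" by simp
    have "C_diss * D t = 3/2 * a / \<mu> * D t + (\<mu>\<^sup>2 / h1 + g * L\<^sup>2) / (\<mu> * g) * D t + K / (2 * q) * D t"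
      unfolding C_diss_def a_def[symmetric] by (simp only: distrib_right)
    thus ?thesis using 1 2 V_eq[of t] by linarith
  qed
  from mult_left_mono[OF this less_imp_le[OF rate_pos]]
  have "rate * V t \<le> rate * (C_diss * D t) + rate * (q * k\<^sup>2 / 2 * (\<xi> t)\<^sup>2)"
    by (simp only: distrib_left)
  moreover have "rate * (C_diss * D t) \<le> \<delta> * D t"
  proof -
    have "rate * C_diss \<le> \<delta>" using C_diss_pos by (simp add: rate_def pos_le_divide_eq[symmetric])
    from mult_right_mono[OF this D] show ?thesis by (simp add: mult.assoc)
  qed
  \<comment> \<open>At rate 2 k the damping of the \<xi> term is used up exactly.\<close>
  moreover have "rate * (q * k\<^sup>2 / 2 * (\<xi> t)\<^sup>2) \<le> q * k^3 * (\<xi> t)\<^sup>2"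
  proof -
    have "rate * (q * k\<^sup>2 / 2 * (\<xi> t)\<^sup>2) \<le> 2 * k * (q * k\<^sup>2 / 2 * (\<xi> t)\<^sup>2)"
      using pos by (intro mult_right_mono) (auto simp: rate_def)
    also have "\<dots> = q * k^3 * (\<xi> t)\<^sup>2" by (simp add: power2_eq_square power3_eq_cube)
    finally show ?thesis .
  qed
  ultimately show ?thesis using qk by (simp add: left_diff_distrib)
qed

lemma N_square:
  assumes t: "0 \<le> t"
  shows "(N t)\<^sup>2 = (\<xi> t)\<^sup>2 + (w t)\<^sup>2 + integral {0..L} (\<lambda>x. (h t x - hs)\<^sup>2) + Slope t
    + integral {0..L} (\<lambda>x. (v t x)\<^sup>2)"
proof -
  interpret p: profile L "h t" "hx t" g \<mu> m "v t" using profile t .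
  show ?thesis
    unfolding X_norm_def prod.case p.L2_norm_eqs
    by (intro real_sqrt_pow2 add_nonneg_nonneg integral_nonneg p.int_Dev p.int_Slope p.int_Vel) auto
qed

lemma N_nonneg: "0 \<le> N t"
  by (simp add: X_norm_def)

text \<open>The comparison with the norm is restricted to the sublevel set of r', since the weights
  h and 1/h in the energies are controlled only there.\<close>

lemma V_le_N:
  assumes t: "0 \<le> t" and V: "V t \<le> r'"
  shows "V t \<le> C_up * (N t)\<^sup>2"
proof -
  interpret p: bounded_profile L "h t" "hx t" g \<mu> m "v t" h1 H using bounded_profile[OF t V] .
  have nn: "0 \<le> p.Dev" "0 \<le> p.Slope" "0 \<le> p.Vel"
    by (intro integral_nonneg p.int_Dev p.int_Slope p.int_Vel; simp)+
  have "V t = 1/2 * p.Kin + 1/2 * p.Mix + g * p.Dev + q * k\<^sup>2 / 2 * (\<xi> t)\<^sup>2 + q / 2 * (y t)\<^sup>2"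
    unfolding V_eq by (simp add: p.W_fun_eq p.E_fun_eq)
  also have "\<dots> \<le> 3/2 * (H * p.Vel) + \<mu>\<^sup>2 / h1 * p.Slope + g * p.Dev
      + q * k\<^sup>2 / 2 * (\<xi> t)\<^sup>2 + q / 2 * (y t)\<^sup>2"
    using p.Mix_le p.Kin_le by simp
  also have "q / 2 * (y t)\<^sup>2 \<le> q / 2 * (2 * (w t)\<^sup>2 + 2 * (k * \<xi> t)\<^sup>2)"
    using pos sum_squares_bound[of "w t" "k * \<xi> t"]
    by (intro mult_left_mono) (auto simp: power2_sum)
  finally have "V t \<le> 3/2 * H * p.Vel + \<mu>\<^sup>2 / h1 * p.Slope + g * p.Dev
      + 3/2 * (q * k\<^sup>2) * (\<xi> t)\<^sup>2 + q * (w t)\<^sup>2"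
    by (simp add: power_mult_distrib algebra_simps)
  also have "\<dots> \<le> C_up * p.Vel + C_up * p.Slope + C_up * p.Dev + C_up * (\<xi> t)\<^sup>2 + C_up * (w t)\<^sup>2"
    unfolding C_up_def using pos nn
    by (intro add_mono mult_right_mono) (auto simp: add_nonneg_nonneg)
  also have "\<dots> = C_up * (N t)\<^sup>2" unfolding N_square[OF t] by (simp add: algebra_simps)
  finally show ?thesis .
qed

lemma N_le_V:
  assumes t: "0 \<le> t" and V: "V t \<le> r'"
  shows "(N t)\<^sup>2 \<le> C_low * V t"
proof -
  interpret p: bounded_profile L "h t" "hx t" g \<mu> m "v t" h1 H using bounded_profile[OF t V] .
  have nn: "0 \<le> p.Dev" "0 \<le> p.Kin" "0 \<le> p.Mix"
    using p.h_pos
    by (intro integral_nonneg p.int_Dev p.int_Kin p.int_Mix; simp add: less_imp_le)+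
  have V_parts: "V t = 1/2 * p.Kin + 1/2 * p.Mix + g * p.Dev + q * k\<^sup>2 / 2 * (\<xi> t)\<^sup>2 + q / 2 * (y t)\<^sup>2"
    unfolding V_eq by (simp add: p.W_fun_eq p.E_fun_eq)
  have nn2: "0 \<le> g * p.Dev" "0 \<le> q * k\<^sup>2 / 2 * (\<xi> t)\<^sup>2" "0 \<le> q / 2 * (y t)\<^sup>2"
    using pos nn by auto
  have "p.Vel \<le> 2 / h1 * V t"
  proof -
    have "h1 * p.Vel \<le> 2 * V t" using p.Kin_ge V_parts nn nn2 by linarith
    thus ?thesis using pos by (simp add: field_simps)
  qed
  moreover have "p.Slope \<le> 4 * H / \<mu>\<^sup>2 * V t"
  proof -
    have "\<mu>\<^sup>2 / (2 * H) * p.Slope \<le> 2 * V t" using p.Mix_ge V_parts nn2 by linarith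
    thus ?thesis using pos by (simp add: field_simps)
  qed
  moreover have "p.Dev \<le> 1 / g * V t"
  proof -
    have "g * p.Dev \<le> V t" using V_parts nn nn2 by linarith
    thus ?thesis using pos by (simp add: field_simps)
  qed
  moreover have \<xi>: "(\<xi> t)\<^sup>2 \<le> 2 / (q * k\<^sup>2) * V t"
  proof -
    have "q * k\<^sup>2 / 2 * (\<xi> t)\<^sup>2 \<le> V t" using V_parts nn nn2 by linarith
    thus ?thesis using pos by (simp add: field_simps)
  qed
  moreover have "(w t)\<^sup>2 \<le> 8 / q * V t"
  proof -
    have "(w t)\<^sup>2 = (y t - k * \<xi> t)\<^sup>2" by simp
    also have "\<dots> \<le> 2 * (y t)\<^sup>2 + 2 * (k * \<xi> t)\<^sup>2"
      using weighted_square_add_le[of 1 1 "y t" "- (k * \<xi> t)"] by simp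
    finally have "q / 2 * (w t)\<^sup>2 \<le> q / 2 * (2 * (y t)\<^sup>2 + 2 * (k * \<xi> t)\<^sup>2)"
      using pos by (intro mult_left_mono) auto
    also have "\<dots> = 2 * (q / 2 * (y t)\<^sup>2) + 2 * (q * k\<^sup>2 / 2 * (\<xi> t)\<^sup>2)"
      by (simp add: power_mult_distrib algebra_simps)
    also have "\<dots> \<le> 4 * V t" using V_parts nn nn2 by linarith
    finally show ?thesis using pos by (simp add: field_simps)
  qed
  ultimately have "(N t)\<^sup>2 \<le> 2 / (q * k\<^sup>2) * V t + 8 / q * V t + 1 / g * V t
      + 4 * H / \<mu>\<^sup>2 * V t + 2 / h1 * V t"
    unfolding N_square[OF t] by linarith
  also have "\<dots> = C_low * V t" unfolding C_low_def by (simp only: distrib_right)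
  finally show ?thesis .
qed

text \<open>V is comparable to the square of the norm, so taking the root halves the rate and yields
  the geometric mean of the two comparison constants.\<close>

lemma exponential_decay:
  assumes init: "V 0 \<le> r" "r < r'" and t: "0 \<le> t"
  shows "V t \<le> r" and "N t \<le> sqrt (C_up * C_low) * exp (- (rate / 2) * t) * N 0"
proof -
  note decay = decay_from_barrier[OF continuous_on_V V_rate V_rate_le V_nonneg rate_pos init t]
  show Vt: "V t \<le> r" by (rule decay)
  have "(N t)\<^sup>2 \<le> C_low * V t" using N_le_V[OF t] Vt init by simp
  also have "\<dots> \<le> C_low * (exp (- rate * t) * V 0)"
    by (rule mult_left_mono[OF decay(2) less_imp_le[OF C_low_pos]])
  also have "\<dots> \<le> C_low * (exp (- rate * t) * (C_up * (N 0)\<^sup>2))"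
  proof (intro mult_left_mono less_imp_le[OF C_low_pos])
    show "V 0 \<le> C_up * (N 0)\<^sup>2" by (rule V_le_N) (use init in auto)
  qed simp
  also have "\<dots> = (sqrt (C_up * C_low) * exp (- (rate / 2) * t) * N 0)\<^sup>2"
  proof -
    have "(exp (- (rate / 2) * t))\<^sup>2 = exp (2 * (- (rate / 2) * t))" by (rule exp_double[symmetric])
    moreover have "2 * (- (rate / 2) * t) = - rate * t" by simp
    moreover have "(sqrt (C_up * C_low))\<^sup>2 = C_up * C_low" using C_low_pos C_up_pos by simp
    ultimately show ?thesis by (simp only: power_mult_distrib mult_ac)
  qed
  finally show "N t \<le> sqrt (C_up * C_low) * exp (- (rate / 2) * t) * N 0"
    by (rule power2_le_imp_le)
       (intro mult_nonneg_nonneg N_nonneg real_sqrt_ge_zero less_imp_le[OF C_low_pos]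
         less_imp_le[OF C_up_pos] exp_ge_zero)
qed

end

theorem theorem1:
  fixes L g \<mu> m Hmax r \<sigma> q k :: real
  assumes "L > 0" and "g > 0" and "\<mu> > 0" and "m > 0" and "Hmax > 0"
    and "m / L < Hmax"
    and "0 \<le> r" and "r < R_const g \<mu> (m / L) Hmax"
    and "\<sigma> > 0" and "q > 0" and "k > 0"
    and "k < q * theta L g \<mu> \<sigma> *
           (G_inv (m / L) (- c_const g \<mu> * r) /
            (b_const L g \<mu> m Hmax \<sigma> + G_inv (m / L) (- c_const g \<mu> * r)))"
  shows "\<exists>M>0. \<exists>lam>0. \<forall>f \<xi> w h v.
    classical_solution L g \<mu> m f \<xi> w h v \<longrightarrow>
    (\<forall>t>0. f t = feedback_law L \<mu> \<sigma> q k (\<xi> t, w t, h t, v t)) \<longrightarrow>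
    V_fun L g \<mu> m q k (\<xi> 0, w 0, h 0, v 0) \<le> r \<longrightarrow>
    (\<forall>t\<ge>0.
      (\<xi> t, w t, h t, v t) \<in> X_set L g \<mu> m Hmax q k \<and>
      X_norm L (\<xi> t, w t, (\<lambda>x. h t x - m / L), v t)
        \<le> M * exp (- lam * t) * X_norm L (\<xi> 0, w 0, (\<lambda>x. h 0 x - m / L), v 0))"
proof -
  define hs where "hs = m / L"
  define c where "c = c_const g \<mu>"
  define R where "R = R_const g \<mu> hs Hmax"
  define \<theta> where "\<theta> = theta L g \<mu> \<sigma>"
  define b where "b = b_const L g \<mu> m Hmax \<sigma>"
  define y0 where "y0 = G_inv hs (- c * r)"
  have hs: "0 < hs" "hs < Hmax" using assms by (auto simp: hs_def)
  have c: "0 < c" using assms by (simp add: c_def c_const_def)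
  have \<theta>: "0 < \<theta>" using assms by (simp add: \<theta>_def theta_def add_pos_pos)
  have b: "0 < b" using assms \<theta> by (simp add: b_def b_const_def \<theta>_def)
  have cR: "c * R \<le> G_fun hs Hmax" "c * R \<le> 4/3 * hs * sqrt hs"
    unfolding c_def R_def using c_R_le assms hs by blast+
  have "c * r < c * R" using c assms by (simp add: R_def hs_def)
  hence "- (4/3 * hs * sqrt hs) < - c * r" using cR(2) unfolding mult_minus_left by linarith
  moreover have "- c * r \<le> 0" using c assms by simp
  ultimately have y0: "0 < y0" "G_fun hs y0 = - c * r"
    unfolding y0_def using G_inv_nonpos[OF hs(1)] by blast+
  have "k * (b + y0) < q * \<theta> * y0"
  proof -
    have "k < q * \<theta> * y0 / (b + y0)"
      using assms(12) by (simp add: \<theta>_def b_def y0_def hs_def c_def)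
    thus ?thesis using b y0 by (simp add: pos_less_divide_eq)
  qed
  hence kb: "k * b < (q * \<theta> - k) * y0" by (simp add: algebra_simps)
  have "0 < k * b" using assms b by simp
  \<comment> \<open>So k b / (q \<theta> - k) is a genuine positive height: the gain condition holds
    for exactly the heights above it.\<close>
  hence gap: "0 < q * \<theta> - k" using kb y0(1) by (smt (verit) mult_nonpos_nonneg)
  have "k * b / (q * \<theta> - k) < y0" using kb gap by (simp add: pos_divide_less_eq mult.commute)
  \<comment> \<open>Lowering the height bound from \<open>y0\<close> to \<open>h1\<close> spends
    part of the slack in the gain condition; strict monotonicity of G turns it into room above the
    level r.\<close>
  then obtain h1 where h1: "k * b / (q * \<theta> - k) < h1" "h1 < y0" using dense by blast
  have "0 < k * b / (q * \<theta> - k)" using gap \<open>0 < k * b\<close> by simp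
  hence h1_pos: "0 < h1" using h1 by linarith
  have "k * b < (q * \<theta> - k) * h1"
    using h1(1) gap by (simp add: pos_divide_less_eq mult.commute)
  hence gain: "k * (b + h1) < q * \<theta> * h1" by (simp add: algebra_simps)
  \<comment> \<open>The largest level that guarantees both the lower bound \<open>h1\<close> and,
    through R, the upper bound \<open>Hmax\<close>.\<close>
  define r' where "r' = min R (- G_fun hs h1 / c)"
  have "G_fun hs h1 < - c * r" using G_fun_strict_mono[OF hs(1) h1_pos h1(2)] y0 by simp
  hence "r * c < - G_fun hs h1" by (simp add: mult.commute)
  hence "r < - G_fun hs h1 / c" using c by (simp only: pos_less_divide_eq)
  hence r': "r < r'" using assms(8) by (simp add: r'_def R_def hs_def)
  have "c * r' \<le> c * R" using c by (simp add: r'_def)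
  hence up: "c * r' \<le> G_fun hs Hmax" using cR by simp
  have "r' \<le> - G_fun hs h1 / c" by (simp add: r'_def)
  hence low: "c * r' \<le> - G_fun hs h1" using c by (simp only: pos_le_divide_eq mult.commute[of c])
  \<comment> \<open>Done before any solution is fixed, so that M and lambda depend on the parameters
    only.\<close>
  interpret gains L g \<mu> m Hmax h1 \<sigma> q k r'
    by (unfold_locales; rule assms(1-5,9-11) h1_pos low[unfolded c_def hs_def]
        up[unfolded c_def hs_def] gain[unfolded b_def \<theta>_def])
  have M_pos: "0 < sqrt (C_up * C_low)" and lam_pos: "0 < rate / 2"
    using C_up_pos C_low_pos rate_pos by auto
  show ?thesis
  proof (rule exI, rule conjI[OF M_pos], rule exI, rule conjI[OF lam_pos], intro allI impI conjI)
    fix f \<xi> w h v and t :: real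
    assume sol: "classical_solution L g \<mu> m f \<xi> w h v"
      and fb: "\<forall>t>0. f t = feedback_law L \<mu> \<sigma> q k (\<xi> t, w t, h t, v t)"
      and init: "V_fun L g \<mu> m q k (\<xi> 0, w 0, h 0, v 0) \<le> r" and t: "0 \<le> t"
    obtain ht hx vt vx hxx hxt vxx where "solution L g \<mu> m f \<xi> w h v ht hx vt vx hxx hxt vxx"
      using classical_solutionE[OF assms(1-4) sol] by blast
    then interpret solution L g \<mu> m f \<xi> w h v ht hx vt vx hxx hxt vxx .
    interpret closed_loop L g \<mu> m Hmax h1 \<sigma> q k r' f \<xi> w h v ht hx vt vx hxx hxt vxx
      by unfold_locales (rule fb[rule_format])
    interpret p: profile L "h t" "hx t" g \<mu> m "v t" using profile[OF t] .
    show "(\<xi> t, w t, h t, v t) \<in> X_set L g \<mu> m Hmax q k"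
      unfolding X_set_def using p.in_S_set no_slip t exponential_decay(1)[OF init r' t] assms(8)
      by simp
    show "X_norm L (\<xi> t, w t, (\<lambda>x. h t x - m / L), v t)
        \<le> sqrt (C_up * C_low) * exp (- (rate / 2) * t)
          * X_norm L (\<xi> 0, w 0, (\<lambda>x. h 0 x - m / L), v 0)"
      by (rule exponential_decay(2)[OF init r' t])
  qed
qed

end
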